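(* Let $A=R/I$ be a graded Artinian Gorenstein algebra of socle degree $j$ with $I_2=\langle w^2,wx,wy\rangle$, and let $H=H(R/I)$. Then (i) $\Delta H_{\le j/2}$ is an $O$-sequence, and (ii) $H=H'+(0,1,1,\dots,1,0)$ for some Gorenstein sequence $H'$ of height three.
   Context: $K$ algebraically closed, $R=K[w,x,y,z]$ standard graded. For $H=(h_0,\dots,h_j)$, $\Delta H_i=h_i-h_{i-1}$ ($h_{-1}=0$) and $\Delta H_{\le j/2}=(\Delta H_i)_{0\le i\le j/2}$. For $c,d>0$ write $c=\sum_{i=1}^d\binom{k(i)}{i}$ with $k(d)>\dots>k(1)\ge0$ and $c^{(d)}=\sum_{i=1}^d\binom{k(i)+1}{i+1}$, $0^{(d)}=0$; an $O$-sequence is a sequence $(1,t_1,t_2,\dots)$ of nonnegative integers with $t_{d+1}\le t_d^{(d)}$ for all $d\ge1$. A Gorenstein sequence of height three is the Hilbert function of a graded Artinian Gorenstein quotient of $K[x,y,z]$ with $h_1=3$. The sequence $(0,1,\dots,1,0)$ has length $j+1$. *)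

theory Defs
  imports Main "HOL-Library.Poly_Mapping" "HOL-Computational_Algebra.Polynomial"
begin

definition alg_closed :: "'k::field itself \<Rightarrow> bool" where
  "alg_closed _ \<longleftrightarrow> (\<forall>p::'k poly. Polynomial.degree p > 0 \<longrightarrow> (\<exists>x. poly p x = 0))"

type_synonym ('v, 'k) mpoly = "('v \<Rightarrow>\<^sub>0 nat) \<Rightarrow>\<^sub>0 'k"

definition mdeg :: "('v \<Rightarrow>\<^sub>0 nat) \<Rightarrow> nat" where
  "mdeg m = (\<Sum>v\<in>Poly_Mapping.keys m. Poly_Mapping.lookup m v)"

definition pscale :: "'k::field \<Rightarrow> ('v, 'k) mpoly \<Rightarrow> ('v, 'k) mpoly" where
  "pscale c p = Poly_Mapping.map (\<lambda>a. c * a) p"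

definition var :: "'v \<Rightarrow> ('v, 'k::field) mpoly" where
  "var v = Poly_Mapping.single (Poly_Mapping.single v 1) 1"

definition homog :: "nat \<Rightarrow> ('v, 'k::field) mpoly set" where
  "homog d = {p. \<forall>m\<in>Poly_Mapping.keys p. mdeg m = d}"

definition hcomp :: "nat \<Rightarrow> ('v, 'k::field) mpoly \<Rightarrow> ('v, 'k) mpoly" where
  "hcomp d p = Abs_poly_mapping (\<lambda>m. if mdeg m = d then Poly_Mapping.lookup p m else 0)"

definition kdim :: "('v, 'k::field) mpoly set \<Rightarrow> nat" where
  "kdim V = vector_space.dim pscale V"

definition kspan :: "('v, 'k::field) mpoly set \<Rightarrow> ('v, 'k) mpoly set" where
  "kspan S = module.span pscale S"

definition homog_ideal :: "('v, 'k::field) mpoly set \<Rightarrow> bool" where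
  "homog_ideal I \<longleftrightarrow> 0 \<in> I \<and> (\<forall>p\<in>I. \<forall>q\<in>I. p + q \<in> I) \<and> (\<forall>p\<in>I. \<forall>r. r * p \<in> I)
     \<and> (\<forall>p\<in>I. \<forall>d. hcomp d p \<in> I)"

text \<open>Hilbert function of R/I: dim_K (R/I)_d = dim_K R_d - dim_K I_d\<close>
definition hilb :: "('v::finite, 'k::field) mpoly set \<Rightarrow> nat \<Rightarrow> nat" where
  "hilb I d = kdim (homog d :: ('v, 'k) mpoly set) - kdim (I \<inter> homog d)"

definition artinian :: "('v::finite, 'k::field) mpoly set \<Rightarrow> bool" where
  "artinian I \<longleftrightarrow> (\<exists>N. \<forall>d\<ge>N. hilb I d = 0)"

text \<open>degree-d piece of the socle (0 :_A m), lifted to R: elements killed by m modulo I\<close>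
definition socle_lift :: "('v::finite, 'k::field) mpoly set \<Rightarrow> nat \<Rightarrow> ('v, 'k) mpoly set" where
  "socle_lift I d = {f \<in> homog d. \<forall>v. var v * f \<in> I}"

definition socle_dim :: "('v::finite, 'k::field) mpoly set \<Rightarrow> nat \<Rightarrow> nat" where
  "socle_dim I d = kdim (socle_lift I d) - kdim (I \<inter> homog d)"

definition graded_AG :: "('v::finite, 'k::field) mpoly set \<Rightarrow> bool" where
  "graded_AG I \<longleftrightarrow> homog_ideal I \<and> artinian I \<and> (\<Sum>d\<in>{d. socle_dim I d \<noteq> 0}. socle_dim I d) = 1
      \<and> finite {d. socle_dim I d \<noteq> 0}"

definition socle_degree :: "('v::finite, 'k::field) mpoly set \<Rightarrow> nat \<Rightarrow> bool" where
  "socle_degree I j \<longleftrightarrow> hilb I j \<noteq> 0 \<and> (\<forall>d>j. hilb I d = 0)"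

datatype var4 = W | X | Y | Z
datatype var3 = X3 | Y3 | Z3

lemma UNIV_var4: "(UNIV :: var4 set) = {W, X, Y, Z}"
  using var4.exhaust by auto
lemma UNIV_var3: "(UNIV :: var3 set) = {X3, Y3, Z3}"
  using var3.exhaust by auto

instance var4 :: finite by standard (simp add: UNIV_var4)
instance var3 :: finite by standard (simp add: UNIV_var3)

definition gorenstein_seq3 :: "'k::field itself \<Rightarrow> nat list \<Rightarrow> bool" where
  "gorenstein_seq3 _ H \<longleftrightarrow> (\<exists>I :: (var3, 'k) mpoly set.
      graded_AG I \<and> hilb I 1 = 3 \<and> H \<noteq> [] \<and> socle_degree I (length H - 1)
      \<and> (\<forall>d<length H. H ! d = hilb I d))"

definition macaulay_rep :: "nat \<Rightarrow> nat \<Rightarrow> (nat \<Rightarrow> nat) \<Rightarrow> bool" where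
  "macaulay_rep c d k \<longleftrightarrow> (\<forall>i. 1 \<le> i \<and> i < d \<longrightarrow> k i < k (Suc i))
      \<and> c = (\<Sum>i=1..d. k i choose i)"

text \<open>c^(d); the representation exists and is unique (for c, d > 0)\<close>
definition mac_pow :: "nat \<Rightarrow> nat \<Rightarrow> nat" where
  "mac_pow c d = (if c = 0 then 0 else
      (let k = (SOME k. macaulay_rep c d k) in \<Sum>i=1..d. (k i + 1) choose (i + 1)))"

definition O_seq :: "int list \<Rightarrow> bool" where
  "O_seq t \<longleftrightarrow> t \<noteq> [] \<and> t ! 0 = 1 \<and> (\<forall>i<length t. t ! i \<ge> 0)
      \<and> (\<forall>d. 1 \<le> d \<and> d + 1 < length t \<longrightarrow> t ! (d + 1) \<le> int (mac_pow (nat (t ! d)) d))"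

definition delta :: "nat list \<Rightarrow> nat \<Rightarrow> int" where
  "delta H i = int (H ! i) - (if i = 0 then 0 else int (H ! (i - 1)))"

end

theory Submission
  imports Defs
begin

text \<open>
  By Macaulay duality \<open>I\<close> is the annihilator of a functional \<open>\<psi>\<close> on \<open>R\<^sub>j\<close>, so every rank
  of a multiplication pairing is symmetric under \<open>i \<mapsto> j - i\<close>. Take a linear form
  \<open>L = z - a x\<close> and let \<open>c\<close> be the Hilbert function of \<open>R/(I, w, L)\<close>, a quotient of
  \<open>K[x,y]\<close>. Since \<open>I\<^sub>2 = w(w,x,y)\<close>, the ideal generated by \<open>w\<close> is spanned modulo \<open>I\<close>
  by the elements \<open>w z\<^sup>i\<close>, which are multiples of \<open>L\<close> modulo \<open>I\<close> for \<open>i > 0\<close>. Comparing the ranks of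
  multiplication by \<open>L\<close> in complementary degrees gives
  \<open>\<Delta>H\<^sub>i = c\<^sub>i - c\<^bsub>j+1-i\<^esub>\<close> for \<open>2 \<le> i \<le> j - 1\<close>.

  Let \<open>t\<close> be the initial degree of \<open>(I, w)/(w)\<close>. Below \<open>t\<close>, multiplication by \<open>L\<close> is injective
  and \<open>\<Delta>H\<^sub>i = i + 1\<close> for \<open>i \<ge> 2\<close>. If \<open>L\<close> does not divide some element of degree \<open>t\<close>, then \<open>c\<close> is
  nonincreasing from degree \<open>t - 1\<close> on, hence so is \<open>\<Delta>H\<close> up to degree \<open>j/2\<close>; this is Zanello's
  elementary argument for Stanley's theorem on height three Gorenstein sequences. It makes \<open>\<Delta>H\<^bsub>\<le>j/2\<^esub>\<close>
  an \<open>O\<close>-sequence.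

  Subtracting \<open>(0,1,\<dots>,1,0)\<close> lowers \<open>\<Delta>H\<^sub>1\<close> from 3 to 2, and what remains counts by degree
  a finite order ideal of monomials in two variables. The corresponding grid points in the plane have this
  sequence as the first difference of their Hilbert function, and the annihilator of the sum of the
  evaluations at these points is a Gorenstein ideal in \<open>K[x,y,z]\<close> with Hilbert function \<open>H'\<close>.
\<close>

section \<open>Dimension and rank in finite-dimensional subspaces\<close>

context vector_space begin

text \<open>Finiteness is a property of the subset, because the spaces of interest are graded pieces
  of an infinite-dimensional polynomial ring.\<close>

definition fin_dim :: "'b set \<Rightarrow> bool" where
  "fin_dim V \<longleftrightarrow> (\<exists>B. finite B \<and> V \<subseteq> span B)"

lemma fin_dim_subset: "U \<subseteq> V \<Longrightarrow> local.fin_dim V \<Longrightarrow> local.fin_dim U"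
  unfolding fin_dim_def by blast

lemma fin_dim_independent_finite:
  assumes "local.fin_dim V" "B \<subseteq> V" "independent B"
  shows "finite B"
proof -
  obtain C where C: "finite C" "V \<subseteq> span C" using assms(1) unfolding fin_dim_def by blast
  then show ?thesis using independent_span_bound[OF C(1) assms(3)] assms(2) by blast
qed

lemma fin_dim_basis_extend:
  assumes "local.fin_dim V" "C \<subseteq> V" "independent C"
  obtains B where "C \<subseteq> B" "B \<subseteq> V" "independent B" "finite B" "V \<subseteq> span B" "card B = dim V"
proof -
  obtain B where B: "C \<subseteq> B" "B \<subseteq> V" "independent B" "V \<subseteq> span B"
    using maximal_independent_subset_extend[OF assms(2,3)] by blast
  show ?thesis
    using that[OF B(1-3) fin_dim_independent_finite[OF assms(1) B(2,3)] B(4)]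
      basis_card_eq_dim[OF B(2,4,3)] by blast
qed

lemma fin_dim_basis:
  assumes "local.fin_dim V"
  obtains B where "B \<subseteq> V" "independent B" "finite B" "V \<subseteq> span B" "card B = dim V"
  using fin_dim_basis_extend[OF assms, of "{}"] independent_empty that by auto

lemma fin_dim_dim_le:
  assumes "U \<subseteq> V" "local.fin_dim V"
  shows "dim U \<le> dim V"
proof -
  obtain B where "B \<subseteq> V" "independent B" "finite B" "V \<subseteq> span B" "card B = dim V"
    using fin_dim_basis[OF assms(2)] .
  then show ?thesis using dim_le_card[of U B] assms(1) by auto
qed

text \<open>A basis of \<open>U\<close> extends to one of \<open>V\<close>; the dimension hypothesis
  leaves no room for added vectors.\<close>

lemma fin_dim_subspace_eq:
  assumes "subspace U" "U \<subseteq> V" "local.fin_dim V" "dim V \<le> dim U"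
  shows "U = V"
proof -
  obtain C where C: "C \<subseteq> U" "independent C" "finite C" "U \<subseteq> span C" "card C = dim U"
    using fin_dim_basis[OF fin_dim_subset[OF assms(2,3)]] .
  obtain B where B: "C \<subseteq> B" "B \<subseteq> V" "independent B" "finite B" "V \<subseteq> span B" "card B = dim V"
    using fin_dim_basis_extend[OF assms(3), of C] C assms(2) by blast
  have "C = B" using card_subset_eq[OF B(4,1)] card_mono[OF B(4,1)] B(6) C(5) assms(4) by auto
  then have "V \<subseteq> U" using B(5) span_minimal[OF C(1) assms(1)] by blast
  then show ?thesis using assms(2) by blast
qed

text \<open>A basis of the kernel together with one vector on which \<open>lam\<close> is nonzero
  spans \<open>V\<close>.\<close>

lemma dim_le_dim_functional_kernel:
  assumes V: "subspace V" "local.fin_dim V"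
    and lam: "\<And>x y. lam (x + y) = lam x + lam y" "\<And>c x. lam (scale c x) = c * lam x"
  shows "dim V \<le> dim {v \<in> V. lam v = 0} + 1"
proof (cases "\<forall>v\<in>V. lam v = 0")
  case True
  then have "{v \<in> V. lam v = 0} = V" by auto
  then show ?thesis by simp
next
  case False
  then obtain v0 where v0: "v0 \<in> V" "lam v0 \<noteq> 0" by auto
  have "local.fin_dim {v \<in> V. lam v = 0}" using V(2) by (rule fin_dim_subset[rotated]) auto
  then obtain B where B: "B \<subseteq> {v \<in> V. lam v = 0}" "independent B" "finite B"
    "{v \<in> V. lam v = 0} \<subseteq> span B" "card B = dim {v \<in> V. lam v = 0}" by (rule fin_dim_basis)
  have "V \<subseteq> span (insert v0 B)"
  proof
    fix v assume v: "v \<in> V"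
    let ?k = "lam v / lam v0"
    have "lam (v - scale ?k v0) + lam (scale ?k v0) = lam v"
      by (subst lam(1)[symmetric]) simp
    then have "lam (v - scale ?k v0) = 0" using v0 by (simp add: lam(2))
    moreover have "v - scale ?k v0 \<in> V" using v v0 V(1) by (simp add: subspace_diff subspace_scale)
    ultimately have "v - scale ?k v0 \<in> span B" using B(4) by auto
    then show "v \<in> span (insert v0 B)" by (auto simp: span_insert)
  qed
  then have "dim V \<le> card (insert v0 B)" using B(3) by (intro dim_le_card) auto
  also have "\<dots> \<le> dim {v \<in> V. lam v = 0} + 1" using B(3,5) by (simp add: card_insert_if)
  finally show ?thesis .
qed

lemma dim_le_dim_functionals_kernel:
  assumes "finite F" "subspace V" "local.fin_dim V"
    and lam: "\<And>b x y. lam b (x + y) = lam b x + lam b y" "\<And>b c x. lam b (scale c x) = c * lam b x"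
  shows "dim V \<le> dim {v \<in> V. \<forall>b\<in>F. lam b v = 0} + card F"
  using assms(1)
proof (induction F)
  case empty
  then show ?case by simp
next
  case (insert b F)
  let ?W = "{v \<in> V. \<forall>b\<in>F. lam b v = 0}"
  have l0: "lam b 0 = 0" for b using lam(2)[of b 0 0] by simp
  have "subspace ?W"
    using assms(2) by (auto simp: subspace_def lam l0)
  moreover have "local.fin_dim ?W" using assms(3) by (rule fin_dim_subset[rotated]) auto
  ultimately have "dim ?W \<le> dim {v \<in> ?W. lam b v = 0} + 1"
    by (rule dim_le_dim_functional_kernel) (rule lam)+
  moreover have "{v \<in> ?W. lam b v = 0} = {v \<in> V. \<forall>b\<in>insert b F. lam b v = 0}" by auto
  ultimately show ?case using insert by simp
qed

text \<open>Extend a basis of the left kernel to a basis of \<open>U\<close>. Only the added vectors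
  impose conditions on \<open>g\<close>, and each condition lowers the dimension by at most
  one.\<close>

lemma bilinear_rank_le:
  assumes U: "subspace U" "local.fin_dim U" and V: "subspace V" "local.fin_dim V"
    and B: "\<And>x y z. B (x + y) z = B x z + B y z" "\<And>c x z. B (scale c x) z = c * B x z"
      "\<And>x y z. B z (x + y) = B z x + B z y" "\<And>c x z. B z (scale c x) = c * B z x"
  shows "dim V + dim {f \<in> U. \<forall>g\<in>V. B f g = 0} \<le> dim U + dim {g \<in> V. \<forall>f\<in>U. B f g = 0}"
proof -
  let ?U0 = "{f \<in> U. \<forall>g\<in>V. B f g = 0}"
  have "local.fin_dim ?U0" using U(2) by (rule fin_dim_subset[rotated]) auto
  then obtain C where C: "C \<subseteq> ?U0" "independent C" "finite C" "?U0 \<subseteq> span C" "card C = dim ?U0"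
    by (rule fin_dim_basis)
  obtain D where D: "C \<subseteq> D" "D \<subseteq> U" "independent D" "finite D" "U \<subseteq> span D" "card D = dim U"
    using fin_dim_basis_extend[OF U(2), of C] C by blast
  have eq: "{g \<in> V. \<forall>f\<in>U. B f g = 0} = {g \<in> V. \<forall>f\<in>D - C. B f g = 0}"
  proof (intro equalityI subsetI)
    fix g assume "g \<in> {g \<in> V. \<forall>f\<in>U. B f g = 0}"
    then show "g \<in> {g \<in> V. \<forall>f\<in>D - C. B f g = 0}" using D by auto
  next
    fix g assume g: "g \<in> {g \<in> V. \<forall>f\<in>D - C. B f g = 0}"
    have "subspace {f. B f g = 0}" using B(2)[of 0 0 g] by (auto simp: subspace_def B(1,2))
    moreover have "D \<subseteq> {f. B f g = 0}" using g C(1) by auto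
    ultimately have "span D \<subseteq> {f. B f g = 0}" by (intro span_minimal)
    then show "g \<in> {g \<in> V. \<forall>f\<in>U. B f g = 0}" using g D(5) by auto
  qed
  have "dim V \<le> dim {g \<in> V. \<forall>f\<in>D - C. B f g = 0} + card (D - C)"
    using D(4) by (intro dim_le_dim_functionals_kernel V) (auto simp: B)
  moreover have "card (D - C) = dim U - dim ?U0" "dim ?U0 \<le> dim U"
    using D C card_Diff_subset[OF C(3) D(1)] card_mono[OF D(4,1)] by auto
  ultimately show ?thesis using eq by simp
qed

text \<open>Row rank equals column rank for a pairing of two different spaces: the inequality is
  applied to the form and to its transpose. Sums replace differences so that no truncated
  subtraction occurs.\<close>

lemma bilinear_rank_sym:
  assumes U: "subspace U" "local.fin_dim U" and V: "subspace V" "local.fin_dim V"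
    and B: "\<And>x y z. B (x + y) z = B x z + B y z" "\<And>c x z. B (scale c x) z = c * B x z"
      "\<And>x y z. B z (x + y) = B z x + B z y" "\<And>c x z. B z (scale c x) = c * B z x"
  shows "dim V + dim {f \<in> U. \<forall>g\<in>V. B f g = 0} = dim U + dim {g \<in> V. \<forall>f\<in>U. B f g = 0}"
proof (rule order_antisym)
  show "dim V + dim {f \<in> U. \<forall>g\<in>V. B f g = 0} \<le> dim U + dim {g \<in> V. \<forall>f\<in>U. B f g = 0}"
    by (rule bilinear_rank_le[OF U V]) (rule B)+
  show "dim U + dim {g \<in> V. \<forall>f\<in>U. B f g = 0} \<le> dim V + dim {f \<in> U. \<forall>g\<in>V. B f g = 0}"
    by (rule bilinear_rank_le[OF V U, of "\<lambda>x y. B y x"]) (rule B)+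
qed

end

lemma (in vector_space_pair) dim_image_plus_dim_kernel:
  assumes f: "Vector_Spaces.linear s1 s2 f" and V: "vs1.subspace V" "vs1.fin_dim V"
  shows "vs1.dim V = vs2.dim (f ` V) + vs1.dim {v \<in> V. f v = 0}"
proof -
  interpret f: Vector_Spaces.linear s1 s2 f by (rule f)
  let ?K = "{v \<in> V. f v = 0}"
  have "vs1.fin_dim ?K" using V(2) by (rule vs1.fin_dim_subset[rotated]) auto
  then obtain C where C: "C \<subseteq> ?K" "vs1.independent C" "finite C" "?K \<subseteq> vs1.span C" "card C = vs1.dim ?K"
    by (rule vs1.fin_dim_basis)
  obtain D where D: "C \<subseteq> D" "D \<subseteq> V" "vs1.independent D" "finite D" "V \<subseteq> vs1.span D" "card D = vs1.dim V"
    using vs1.fin_dim_basis_extend[OF V(2), of C] C by blast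
  have DV: "vs1.span (D - C) \<subseteq> V" using D(2) V(1) by (intro vs1.span_minimal) auto
  have inj: "inj_on f (vs1.span (D - C))"
    unfolding f.inj_on_iff_eq_0[OF vs1.subspace_span]
  proof (intro ballI impI)
    fix x assume x: "x \<in> vs1.span (D - C)" "f x = 0"
    then have "x \<in> vs1.span C" using C(4) DV by auto
    \<comment> \<open>The representation over \<open>D\<close> of a common element is supported both
      in \<open>C\<close> and in \<open>D - C\<close>, hence is zero.\<close>
    moreover have "vs1.span C \<inter> vs1.span (D - C) = {0}"
    proof -
      have "vs1.independent (C \<union> (D - C))" using D(1,3) by (simp add: Un_absorb1)
      then have "x = 0" if "x \<in> vs1.span C" "x \<in> vs1.span (D - C)" for x
      proof -
        have "vs1.representation D x = vs1.representation C x"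
          using vs1.representation_extend[OF D(3) that(1) D(1)] .
        moreover have "vs1.representation D x = vs1.representation (D - C) x"
          using vs1.representation_extend[OF D(3) that(2)] by auto
        ultimately have z: "vs1.representation D x b = 0" for b
          by (metis DiffE vs1.representation_ne_zero)
        have "x \<in> vs1.span D" using that(1) vs1.span_mono[OF D(1)] by auto
        then show "x = 0" using vs1.sum_representation_eq[OF D(3) _ D(4) order_refl, of x] z by simp
      qed
      then show ?thesis using vs1.span_zero by auto
    qed
    ultimately show "x = 0" using x by auto
  qed
  have ind: "vs2.independent (f ` (D - C))"
    using vs1.independent_mono[OF D(3)] inj by (intro f.independent_injective_image) auto
  have "f ` V \<subseteq> vs2.span (f ` (D - C))"
  proof
    fix y assume "y \<in> f ` V"
    then obtain x where x: "x \<in> V" "y = f x" by auto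
    then have "x \<in> vs1.span (C \<union> (D - C))" using D(1,5) by (auto simp: Un_absorb1)
    then obtain a b where "x = a + b" "a \<in> vs1.span C" "b \<in> vs1.span (D - C)"
      unfolding vs1.span_Un by blast
    moreover have "f a = 0"
      using f.eq_0_on_span[of C a] C(1) calculation by auto
    ultimately have "y = f b" using x by (simp add: f.add)
    then show "y \<in> vs2.span (f ` (D - C))" using \<open>b \<in> _\<close> by (simp add: f.span_image)
  qed
  then have "vs2.dim (f ` V) = card (f ` (D - C))"
    using ind D(2) by (intro vs2.dim_unique) auto
  also have "\<dots> = card (D - C)"
    using inj vs1.span_superset by (intro card_image) (meson inj_on_subset)
  finally show ?thesis using C D card_Diff_subset[OF C(3) D(1)] card_mono[OF D(4,1)] by auto
qed

section \<open>Graded pieces of the polynomial ring\<close>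

abbreviation (input) "lookup \<equiv> Poly_Mapping.lookup"
abbreviation (input) "keys \<equiv> Poly_Mapping.keys"

lemma lookup_pscale [simp]: "lookup (pscale c p) m = c * lookup p m"
  unfolding pscale_def by (simp add: Poly_Mapping.map.rep_eq when_def)

lemma vector_space_pscale: "vector_space (pscale :: 'k::field \<Rightarrow> ('v, 'k) mpoly \<Rightarrow> ('v, 'k) mpoly)"
  by unfold_locales (rule poly_mapping_eqI, simp add: lookup_add algebra_simps)+

interpretation mp: vector_space "pscale :: 'k::field \<Rightarrow> ('v, 'k) mpoly \<Rightarrow> ('v, 'k) mpoly"
  by (rule vector_space_pscale)

lemma pscale_conv_mult: "pscale c p = Poly_Mapping.single 0 c * p"
  unfolding pscale_def by (rule mult_map_scale_conv_mult)

lemma pscale_mult_left [simp]: "pscale c p * q = pscale c (p * q)"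
  by (simp add: pscale_conv_mult mult.assoc)

lemma pscale_mult_right [simp]: "p * pscale c q = pscale c (p * q)"
  by (simp add: pscale_conv_mult mult.left_commute)

lemma mdeg_UNIV: "mdeg (m :: 'v::finite \<Rightarrow>\<^sub>0 nat) = (\<Sum>v\<in>UNIV. lookup m v)"
  unfolding mdeg_def by (rule sum.mono_neutral_left) (auto simp: in_keys_iff)

lemma mdeg_add [simp]: "mdeg (m + n :: 'v::finite \<Rightarrow>\<^sub>0 nat) = mdeg m + mdeg n"
  by (simp add: mdeg_UNIV lookup_add sum.distrib)

lemma mdeg_single [simp]: "mdeg (Poly_Mapping.single v n) = n"
  by (simp add: mdeg_def)

lemma mdeg_0 [simp]: "mdeg 0 = 0"
  by (simp add: mdeg_def)

lemma mdeg_eq_0_iff [simp]: "mdeg m = 0 \<longleftrightarrow> m = 0"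
proof
  assume "mdeg m = 0"
  then have "\<forall>v\<in>keys m. lookup m v = 0" unfolding mdeg_def by simp
  then have "keys m = {}" by (metis all_not_in_conv in_keys_iff)
  then show "m = 0" by (metis poly_mapping_eqI in_keys_iff empty_iff lookup_zero)
qed simp

lemma mdeg_SucE:
  assumes "mdeg (m :: 'v::finite \<Rightarrow>\<^sub>0 nat) = Suc d"
  obtains v m' where "m = Poly_Mapping.single v 1 + m'" "mdeg m' = d"
proof -
  have "m \<noteq> 0" using assms by auto
  then obtain v where v: "lookup m v \<noteq> 0" by (metis poly_mapping_eqI lookup_zero)
  define m' where "m' = m - Poly_Mapping.single v 1"
  have m: "m = Poly_Mapping.single v 1 + m'"
    by (rule poly_mapping_eqI) (use v in \<open>auto simp: m'_def lookup_add lookup_minus lookup_single when_def\<close>)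
  have "mdeg m = 1 + mdeg m'" by (subst m) simp
  then show ?thesis using that m assms by simp
qed

lemma finite_mdeg: "finite {m :: 'v::finite \<Rightarrow>\<^sub>0 nat. mdeg m = d}"
proof (induction d)
  case 0
  then show ?case by simp
next
  case (Suc d)
  have "{m :: 'v \<Rightarrow>\<^sub>0 nat. mdeg m = Suc d}
      \<subseteq> (\<Union>v. (\<lambda>m'. Poly_Mapping.single v 1 + m') ` {m'. mdeg m' = d})"
  proof clarify
    fix m :: "'v \<Rightarrow>\<^sub>0 nat" assume "mdeg m = Suc d"
    then obtain v m' where "m = Poly_Mapping.single v 1 + m'" "mdeg m' = d" by (rule mdeg_SucE)
    then show "m \<in> (\<Union>v. (\<lambda>m'. Poly_Mapping.single v 1 + m') ` {m'. mdeg m' = d})" by blast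
  qed
  then show ?case using Suc by (auto intro: finite_subset)
qed

lemma mpoly_sum_monomials:
  "p = (\<Sum>m\<in>keys p. pscale (lookup p m) (Poly_Mapping.single m (1::'k::field)))"
proof (rule poly_mapping_eqI)
  fix n
  have "lookup (\<Sum>m\<in>keys p. pscale (lookup p m) (Poly_Mapping.single m (1::'k))) n
      = (\<Sum>m\<in>keys p. if m = n then lookup p n else 0)"
    unfolding lookup_sum by (rule sum.cong) (auto simp: lookup_single when_def)
  also have "\<dots> = lookup p n" by (simp add: in_keys_iff)
  finally show "lookup p n = lookup (\<Sum>m\<in>keys p. pscale (lookup p m) (Poly_Mapping.single m (1::'k))) n"
    by simp
qed

lemma homogD: "p \<in> homog d \<Longrightarrow> lookup p m \<noteq> 0 \<Longrightarrow> mdeg m = d"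
  unfolding homog_def by (auto simp: in_keys_iff)

lemma homog_iff: "p \<in> homog d \<longleftrightarrow> (\<forall>m. lookup p m \<noteq> 0 \<longrightarrow> mdeg m = d)"
  unfolding homog_def by (auto simp: in_keys_iff)

lemma subspace_homog [simp]: "mp.subspace (homog d :: ('v, 'k::field) mpoly set)"
proof (rule mp.subspaceI)
  fix p q :: "('v, 'k) mpoly" assume "p \<in> homog d" "q \<in> homog d"
  then show "p + q \<in> homog d" using keys_add[of p q] unfolding homog_def by blast
qed (auto simp: homog_iff)

lemma homog_0_mem [simp]: "0 \<in> homog d"
  by (simp add: homog_iff)

lemma homog_add: "p \<in> homog d \<Longrightarrow> q \<in> homog d \<Longrightarrow> p + q \<in> homog d"
  using mp.subspace_add[OF subspace_homog] .

lemma homog_diff: "p \<in> homog d \<Longrightarrow> q \<in> homog d \<Longrightarrow> p - q \<in> homog d"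
  using mp.subspace_diff[OF subspace_homog] .

lemma homog_pscale: "p \<in> homog d \<Longrightarrow> pscale c p \<in> homog d"
  using mp.subspace_scale[OF subspace_homog] .

lemma single_homog: "Poly_Mapping.single m c \<in> homog (mdeg m)"
  by (auto simp: homog_iff lookup_single when_def split: if_splits)

lemma one_homog [simp]: "1 \<in> homog 0"
  by (auto simp: homog_iff lookup_one when_def split: if_splits)

lemma var_homog [simp]: "(var v :: ('v, 'k::field) mpoly) \<in> homog 1" "(var v :: ('v, 'k) mpoly) \<in> homog (Suc 0)"
  using single_homog[of "Poly_Mapping.single v 1" "1::'k"] unfolding var_def by simp_all

lemma homog_mult:
  fixes p q :: "('v::finite, 'k::field) mpoly"
  assumes "p \<in> homog d" "q \<in> homog e"
  shows "p * q \<in> homog (d + e)"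
  using assms keys_mult[of p q] unfolding homog_def by fastforce

lemma homog_var_mult:
  fixes q :: "('v::finite, 'k::field) mpoly"
  shows "q \<in> homog d \<Longrightarrow> var v * q \<in> homog (Suc d)"
  using homog_mult[OF var_homog(1), of q d v] by simp

lemma homog_power:
  fixes p :: "('v::finite, 'k::field) mpoly"
  assumes "p \<in> homog d"
  shows "p ^ n \<in> homog (n * d)"
proof (induction n)
  case (Suc n)
  then show ?case using homog_mult[OF assms Suc] by simp
qed simp

lemma homog_subset_span_monomials:
  "homog d \<subseteq> mp.span ((\<lambda>m. Poly_Mapping.single m (1::'k::field)) ` {m :: 'v \<Rightarrow>\<^sub>0 nat. mdeg m = d})"
proof
  fix p :: "('v, 'k) mpoly" assume p: "p \<in> homog d"
  have "(\<Sum>m\<in>keys p. pscale (lookup p m) (Poly_Mapping.single m (1::'k)))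
      \<in> mp.span ((\<lambda>m. Poly_Mapping.single m (1::'k)) ` {m. mdeg m = d})"
    using p unfolding homog_def by (intro mp.span_sum mp.span_scale mp.span_base) auto
  then show "p \<in> mp.span ((\<lambda>m. Poly_Mapping.single m (1::'k)) ` {m. mdeg m = d})"
    by (simp flip: mpoly_sum_monomials)
qed

lemma fin_dim_homog [simp]: "mp.fin_dim (homog d :: ('v::finite, 'k::field) mpoly set)"
  unfolding mp.fin_dim_def using homog_subset_span_monomials finite_imageI[OF finite_mdeg] by blast

lemma homog_0E:
  assumes "p \<in> homog 0"
  obtains c where "p = pscale c (1 :: ('v, 'k::field) mpoly)"
proof
  show "p = pscale (lookup p 0) 1"
    by (rule poly_mapping_eqI) (use homogD[OF assms] in \<open>force simp: lookup_one when_def\<close>)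
qed

text \<open>Every monomial of degree \<open>Suc d\<close> is a variable times a monomial of degree
  \<open>d\<close>. This is the induction step for all later containments of graded pieces.\<close>

lemma homog_Suc_subset:
  fixes S :: "('v::finite, 'k::field) mpoly set"
  assumes S: "mp.subspace S" and step: "\<And>v q. q \<in> homog d \<Longrightarrow> var v * q \<in> S"
  shows "homog (Suc d) \<subseteq> S"
proof -
  have "(\<lambda>m. Poly_Mapping.single m (1::'k)) ` {m :: 'v \<Rightarrow>\<^sub>0 nat. mdeg m = Suc d} \<subseteq> S"
  proof clarify
    fix m :: "'v \<Rightarrow>\<^sub>0 nat" assume "mdeg m = Suc d"
    then obtain v m' where m: "m = Poly_Mapping.single v 1 + m'" "mdeg m' = d" by (rule mdeg_SucE)
    have "Poly_Mapping.single m (1::'k) = var v * Poly_Mapping.single m' 1"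
      by (simp add: m var_def mult_single)
    then show "Poly_Mapping.single m (1::'k) \<in> S"
      using step[of "Poly_Mapping.single m' 1" v] single_homog[of m' 1] m by simp
  qed
  then show ?thesis using homog_subset_span_monomials mp.span_minimal[OF _ S] by blast
qed

lemma lookup_hcomp [simp]: "lookup (hcomp d p) m = (if mdeg m = d then lookup p m else 0)"
proof -
  have "finite {m. (if mdeg m = d then lookup p m else 0) \<noteq> 0}"
    by (rule finite_subset[OF _ finite_keys[of p]]) (auto simp: in_keys_iff)
  then show ?thesis unfolding hcomp_def by simp
qed

lemma hcomp_homog [simp]: "hcomp d p \<in> homog d"
  by (auto simp: homog_iff split: if_splits)

lemma hcomp_add: "hcomp d (p + q) = hcomp d p + hcomp d q"
  by (rule poly_mapping_eqI) (simp add: lookup_add)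

lemma hcomp_0 [simp]: "hcomp d 0 = 0"
  by (rule poly_mapping_eqI) simp

lemma hcomp_pscale: "hcomp d (pscale c p) = pscale c (hcomp d p)"
  by (rule poly_mapping_eqI) simp

lemma hcomp_of_homog: "p \<in> homog e \<Longrightarrow> hcomp d p = (if d = e then p else 0)"
  by (rule poly_mapping_eqI) (auto simp: homog_iff)

lemma hcomp_sum: "hcomp d (sum f A) = (\<Sum>x\<in>A. hcomp d (f x))"
  by (induction A rule: infinite_finite_induct) (auto simp: hcomp_add)

lemma mpoly_sum_hcomp: "p = (\<Sum>d\<in>mdeg ` keys p. hcomp d p)"
proof (rule poly_mapping_eqI)
  fix n
  have "lookup (\<Sum>d\<in>mdeg ` keys p. hcomp d p) n = (\<Sum>d\<in>mdeg ` keys p. if d = mdeg n then lookup p n else 0)"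
    unfolding lookup_sum by (rule sum.cong) auto
  also have "\<dots> = lookup p n" by (auto simp: in_keys_iff)
  finally show "lookup p n = lookup (\<Sum>d\<in>mdeg ` keys p. hcomp d p) n" by simp
qed

text \<open>Expanding \<open>p\<close> into its homogeneous components, only the one of degree
  \<open>d - e\<close> can contribute; for \<open>e > d\<close> there is none, and the case split
  guards against truncated subtraction.\<close>

lemma hcomp_mult_homog:
  fixes p q :: "('v::finite, 'k::field) mpoly"
  assumes q: "q \<in> homog e"
  shows "hcomp d (p * q) = (if e \<le> d then hcomp (d - e) p * q else 0)"
proof -
  have "hcomp d (p * q) = hcomp d (\<Sum>i\<in>mdeg ` keys p. hcomp i p * q)"
    by (subst mpoly_sum_hcomp[of p]) (simp add: sum_distrib_right)
  also have "\<dots> = (\<Sum>i\<in>mdeg ` keys p. if d = i + e then hcomp i p * q else 0)"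
    unfolding hcomp_sum
    by (rule sum.cong) (use hcomp_of_homog[OF homog_mult[OF hcomp_homog q]] in auto)
  also have "\<dots> = (if e \<le> d then hcomp (d - e) p * q else 0)"
  proof (cases "e \<le> d \<and> d - e \<in> mdeg ` keys p")
    case True
    then have "(\<Sum>i\<in>mdeg ` keys p. if d = i + e then hcomp i p * q else 0)
        = (\<Sum>i\<in>mdeg ` keys p. if i = d - e then hcomp i p * q else 0)"
      by (intro sum.cong) auto
    then show ?thesis using True by simp
  next
    case False
    have "hcomp (d - e) p = 0" if "e \<le> d"
    proof (rule poly_mapping_eqI)
      fix m
      have "lookup p m = 0" if "mdeg m = d - e"
      proof (rule ccontr)
        assume "lookup p m \<noteq> 0"
        then have "mdeg m \<in> mdeg ` keys p" by (simp add: in_keys_iff)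
        then show False using False that \<open>e \<le> d\<close> by simp
      qed
      then show "lookup (hcomp (d - e) p) m = lookup 0 m" by simp
    qed
    moreover have "(\<Sum>i\<in>mdeg ` keys p. if d = i + e then hcomp i p * q else 0) = 0"
      using False by (intro sum.neutral) auto
    ultimately show ?thesis by simp
  qed
  finally show ?thesis .
qed

lemma homog_ideal_subspace: "homog_ideal I \<Longrightarrow> mp.subspace I"
  unfolding homog_ideal_def mp.subspace_def pscale_conv_mult by auto

lemma homog_ideal_mult: "homog_ideal I \<Longrightarrow> p \<in> I \<Longrightarrow> r * p \<in> I"
  unfolding homog_ideal_def by blast

lemma homog_ideal_hcomp: "homog_ideal I \<Longrightarrow> p \<in> I \<Longrightarrow> hcomp d p \<in> I"
  unfolding homog_ideal_def by blast

section \<open>Evaluation homomorphisms out of the polynomial ring\<close>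

locale mpoly_eval =
  fixes h :: "'k::field \<Rightarrow> 'r::comm_ring_1" and \<rho> :: "'v::finite \<Rightarrow> 'r"
  assumes h_add: "h (a + b) = h a + h b" and h_mult: "h (a * b) = h a * h b" and h_1: "h 1 = 1"
begin

text \<open>The ring homomorphism that extends \<open>h\<close> on coefficients. A general target
  covers both dehomogenisation, with values in \<open>K[y][z]\<close>, and evaluation at a
  point.\<close>

definition ev :: "('v, 'k) mpoly \<Rightarrow> 'r" where
  "ev p = (\<Sum>m\<in>keys p. h (lookup p m) * (\<Prod>v\<in>UNIV. \<rho> v ^ lookup m v))"

lemma h_0: "h 0 = 0"
  using h_add[of 0 0] by simp

text \<open>Puts the values of several polynomials over one common index set, so that they can be
  compared termwise.\<close>

lemma ev_superset:
  assumes "finite A" "keys p \<subseteq> A"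
  shows "ev p = (\<Sum>m\<in>A. h (lookup p m) * (\<Prod>v\<in>UNIV. \<rho> v ^ lookup m v))"
  unfolding ev_def by (rule sum.mono_neutral_left) (use assms in \<open>auto simp: in_keys_iff h_0\<close>)

lemma ev_0 [simp]: "ev 0 = 0"
  by (simp add: ev_def)

lemma ev_add: "ev (p + q) = ev p + ev q"
  using ev_superset[of "keys p \<union> keys q" p] ev_superset[of "keys p \<union> keys q" q]
    ev_superset[of "keys p \<union> keys q" "p + q"] keys_add[of p q]
  by (simp add: lookup_add h_add distrib_right sum.distrib)

lemma ev_pscale: "ev (pscale c p) = h c * ev p"
proof -
  have "keys (pscale c p) \<subseteq> keys p" by (auto simp: in_keys_iff)
  then show ?thesis using ev_superset[of "keys p" "pscale c p"] ev_superset[of "keys p" p]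
    by (simp add: h_mult sum_distrib_left mult.assoc)
qed

lemma ev_sum: "ev (sum f A) = (\<Sum>x\<in>A. ev (f x))"
  by (induction A rule: infinite_finite_induct) (auto simp: ev_add)

lemma ev_uminus: "ev (- p) = - ev p"
  using ev_add[of p "- p"] by (simp add: eq_neg_iff_add_eq_0 add.commute)

lemma ev_diff: "ev (p - q) = ev p - ev q"
  using ev_add[of p "- q"] by (simp add: ev_uminus)

lemma ev_monomial: "ev (Poly_Mapping.single m 1) = (\<Prod>v\<in>UNIV. \<rho> v ^ lookup m v)"
  by (simp add: ev_def h_1)

lemma ev_var [simp]: "ev (var v) = \<rho> v"
proof -
  have "(\<Prod>u\<in>UNIV. \<rho> u ^ lookup (Poly_Mapping.single v (1::nat)) u) = (\<Prod>u\<in>UNIV. if u = v then \<rho> u else 1)"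
    by (rule prod.cong) (auto simp: lookup_single when_def)
  then show ?thesis by (simp add: var_def ev_monomial)
qed

lemma ev_1 [simp]: "ev 1 = 1"
  using ev_monomial[of 0] by simp

lemma ev_mult: "ev (p * q) = ev p * ev q"
proof -
  let ?e = "\<lambda>m. Poly_Mapping.single m (1::'k)"
  have mm: "ev (?e m * ?e n) = ev (?e m) * ev (?e n)" for m n
    by (simp add: mult_single ev_monomial lookup_add power_add prod.distrib)
  define P where "P = (\<Sum>m\<in>keys p. pscale (lookup p m) (?e m))"
  define Q where "Q = (\<Sum>n\<in>keys q. pscale (lookup q n) (?e n))"
  have "ev (P * Q) = (\<Sum>m\<in>keys p. \<Sum>n\<in>keys q.
      ev (pscale (lookup p m) (?e m)) * ev (pscale (lookup q n) (?e n)))"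
    unfolding P_def Q_def sum_product ev_sum
    by (simp only: pscale_mult_left pscale_mult_right ev_pscale mm mult_ac)
  also have "\<dots> = ev P * ev Q"
    unfolding P_def Q_def by (simp only: ev_sum sum_product)
  finally show ?thesis
    unfolding P_def Q_def by (simp only: mpoly_sum_monomials[symmetric])
qed

lemma ev_power: "ev (p ^ n) = ev p ^ n"
  by (induction n) (auto simp: ev_mult)

lemma ev_prod: "ev (prod f A) = (\<Prod>x\<in>A. ev (f x))"
  by (induction A rule: infinite_finite_induct) (auto simp: ev_mult)

end

section \<open>Macaulay duality\<close>

lemma homog_ideal_piece:
  assumes "homog_ideal (I :: ('v::finite, 'k::field) mpoly set)"
  shows "mp.subspace (I \<inter> homog d)" "mp.fin_dim (I \<inter> homog d)"
    "kdim (I \<inter> homog d) \<le> kdim (homog d :: ('v, 'k) mpoly set)"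
proof -
  show "mp.subspace (I \<inter> homog d)"
    using mp.subspace_inter[OF homog_ideal_subspace[OF assms] subspace_homog] .
  show "mp.fin_dim (I \<inter> homog d)"
    by (rule mp.fin_dim_subset[OF _ fin_dim_homog]) auto
  show "kdim (I \<inter> homog d) \<le> kdim (homog d :: ('v, 'k) mpoly set)"
    unfolding kdim_def by (rule mp.fin_dim_dim_le) auto
qed

lemma hilb_eq_0_iff:
  assumes "homog_ideal (I :: ('v::finite, 'k::field) mpoly set)"
  shows "hilb I d = 0 \<longleftrightarrow> homog d \<subseteq> I"
proof
  assume "hilb I d = 0"
  then have "mp.dim (homog d :: ('v, 'k) mpoly set) \<le> mp.dim (I \<inter> homog d)"
    unfolding hilb_def kdim_def by simp
  then have "I \<inter> homog d = homog d"
    using homog_ideal_piece(1)[OF assms] by (intro mp.fin_dim_subspace_eq) auto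
  then show "homog d \<subseteq> I" by blast
next
  assume "homog d \<subseteq> I"
  then have "I \<inter> homog d = homog d" by blast
  then show "hilb I d = 0" by (simp add: hilb_def)
qed

lemma homog_ideal_eqI:
  assumes "homog_ideal (I :: ('v::finite, 'k::field) mpoly set)" "homog_ideal J"
    and "\<And>d. I \<inter> homog d = J \<inter> homog d"
  shows "I = J"
proof -
  have "p \<in> J" if "homog_ideal I" "homog_ideal J" "\<And>d. I \<inter> homog d = J \<inter> homog d" "p \<in> I"
    for I J :: "('v, 'k) mpoly set" and p
  proof -
    have "hcomp d p \<in> J" for d using homog_ideal_hcomp[OF that(1,4)] that(3)[of d] by auto
    then have "(\<Sum>d\<in>mdeg ` keys p. hcomp d p) \<in> J"
      by (intro mp.subspace_sum[OF homog_ideal_subspace[OF that(2)]])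
    then show "p \<in> J" by (simp only: mpoly_sum_hcomp[symmetric])
  qed
  from this[OF assms] this[OF assms(2,1) assms(3)[symmetric]] show ?thesis by auto
qed

text \<open>Such a functional is an element of degree \<open>j\<close> of Macaulay's inverse system, extended by zero to
  the other degrees; \<open>Ann\<close> is the ideal with this dual generator.\<close>

locale graded_functional =
  fixes \<psi> :: "('v::finite, 'k::field) mpoly \<Rightarrow> 'k" and j :: nat
  assumes psi_add: "\<psi> (f + g) = \<psi> f + \<psi> g"
    and psi_pscale: "\<psi> (pscale c f) = c * \<psi> f"
    and psi_hcomp: "\<psi> (hcomp j f) = \<psi> f"
begin

definition Ann :: "('v, 'k) mpoly set" where
  "Ann = {f. \<forall>g. \<psi> (f * g) = 0}"

lemma psi_0 [simp]: "\<psi> 0 = 0"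
  using psi_pscale[of 0 0] by simp

text \<open>Only the degree \<open>j\<close> component of a product is seen by
  \<open>\<psi>\<close>, so \<open>f\<close> is tested against degree \<open>j - d\<close> alone,
  and against nothing if \<open>d > j\<close>.\<close>

lemma psi_mult_homog:
  assumes "f \<in> homog d"
  shows "\<psi> (f * g) = (if d \<le> j then \<psi> (f * hcomp (j - d) g) else 0)"
  using psi_hcomp[of "g * f"] hcomp_mult_homog[OF assms, of j g] by (auto simp: mult.commute)

lemma Ann_homog:
  assumes "d \<le> j"
  shows "Ann \<inter> homog d = {f \<in> homog d. \<forall>g\<in>homog (j - d). \<psi> (f * g) = 0}"
proof (intro equalityI subsetI)
  fix f assume "f \<in> {f \<in> homog d. \<forall>g\<in>homog (j - d). \<psi> (f * g) = 0}"
  then show "f \<in> Ann \<inter> homog d"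
    using psi_mult_homog[of f d] assms hcomp_homog by (simp add: Ann_def)
qed (simp add: Ann_def)

lemma Ann_homog_gt: "j < d \<Longrightarrow> homog d \<subseteq> Ann"
  using psi_mult_homog[of _ d] by (auto simp: Ann_def)

lemma homog_ideal_Ann: "homog_ideal Ann"
  unfolding homog_ideal_def
proof (intro conjI ballI allI)
  show "0 \<in> Ann" by (simp add: Ann_def)
  show "p + q \<in> Ann" if "p \<in> Ann" "q \<in> Ann" for p q
    using that by (simp add: Ann_def distrib_right psi_add)
  show "r * p \<in> Ann" if "p \<in> Ann" for p r
  proof -
    have "\<psi> (p * (r * g)) = 0" for g using that unfolding Ann_def by blast
    then show ?thesis by (simp add: Ann_def mult_ac)
  qed
  show "hcomp d p \<in> Ann" if "p \<in> Ann" for p d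
  proof -
    have "\<psi> (hcomp d p * g) = 0" if d: "d \<le> j" for g
    proof -
      have "\<psi> (hcomp d p * g) = \<psi> (hcomp d p * hcomp (j - d) g)"
        using psi_mult_homog[OF hcomp_homog, of d p g] d by simp
      also have "hcomp d p * hcomp (j - d) g = hcomp j (p * hcomp (j - d) g)"
        using hcomp_mult_homog[OF hcomp_homog, of j p "j - d" g] d by simp
      also have "\<psi> \<dots> = 0"
        unfolding psi_hcomp using \<open>p \<in> Ann\<close> by (simp add: Ann_def)
      finally show ?thesis .
    qed
    moreover have "\<psi> (hcomp d p * g) = 0" if "\<not> d \<le> j" for g
      by (subst psi_mult_homog[OF hcomp_homog]) (simp add: that)
    ultimately show ?thesis unfolding Ann_def by blast
  qed
qed

text \<open>The form sending \<open>f\<close>, \<open>g\<close> to \<open>\<psi> (p * f * g)\<close>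
  is unchanged when its arguments are exchanged, so both sides compare the two kernels of one
  pairing between degrees \<open>a\<close> and \<open>b\<close>.\<close>

lemma multiplication_rank_sym:
  "mp.dim (homog b :: ('v, 'k) mpoly set) + mp.dim {f \<in> homog a. \<forall>g\<in>homog b. \<psi> (p * f * g) = 0}
    = mp.dim (homog a :: ('v, 'k) mpoly set) + mp.dim {f \<in> homog b. \<forall>g\<in>homog a. \<psi> (p * f * g) = 0}"
proof -
  have "p * f * g = p * g * f" for f g :: "('v, 'k) mpoly" by (simp add: mult_ac)
  then have sym: "\<psi> (p * f * g) = \<psi> (p * g * f)" for f g by (rule arg_cong)
  have eq: "{f \<in> homog b. \<forall>g\<in>homog a. \<psi> (p * f * g) = 0} = {g \<in> homog b. \<forall>f\<in>homog a. \<psi> (p * f * g) = 0}"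
    by (intro Collect_cong conj_cong ball_cong refl) (subst sym, rule refl)
  show ?thesis unfolding eq
    by (rule mp.bilinear_rank_sym)
      (simp_all add: psi_add psi_pscale distrib_left distrib_right)
qed

lemma hilb_Ann_sym:
  assumes "d \<le> j"
  shows "hilb Ann d = hilb Ann (j - d)"
proof -
  have "j - (j - d) = d" "j - d \<le> j" using assms by auto
  then have "Ann \<inter> homog (j - d) = {f \<in> homog (j - d). \<forall>g\<in>homog d. \<psi> (1 * f * g) = 0}"
    using Ann_homog[of "j - d"] by simp
  moreover have "Ann \<inter> homog d = {f \<in> homog d. \<forall>g\<in>homog (j - d). \<psi> (1 * f * g) = 0}"
    using Ann_homog[OF assms] by simp
  ultimately show ?thesis
    using multiplication_rank_sym[where a = d and b = "j - d" and p = 1] unfolding hilb_def kdim_def by simp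
qed

text \<open>As \<open>d < j\<close>, the space of degree \<open>j - d\<close> is generated by
  products of a variable with a form of degree \<open>j - d - 1\<close>; hence the pairing of
  \<open>f\<close> is determined by those of the \<open>var v * f\<close>.\<close>

lemma Ann_socle:
  assumes f: "f \<in> homog d" "d < j" and v: "\<And>v. var v * f \<in> Ann"
  shows "f \<in> Ann"
proof -
  have sub: "mp.subspace {g. \<psi> (f * g) = 0}"
    by (auto simp: mp.subspace_def psi_add psi_pscale distrib_left)
  have "homog (Suc (j - d - 1)) \<subseteq> {g. \<psi> (f * g) = 0}"
  proof (rule homog_Suc_subset[OF sub])
    fix u and q :: "('v, 'k) mpoly"
    have "\<psi> (var u * f * q) = 0" using v[of u] unfolding Ann_def by blast
    then show "var u * q \<in> {g. \<psi> (f * g) = 0}" by (simp add: mult_ac)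
  qed
  moreover have "Suc (j - d - 1) = j - d" using f(2) by simp
  ultimately have "f \<in> {f \<in> homog d. \<forall>g\<in>homog (j - d). \<psi> (f * g) = 0}" using f by auto
  then show ?thesis using Ann_homog[of d] f by auto
qed

text \<open>A nonzero \<open>\<psi>\<close> keeps the constants out of \<open>Ann\<close>, so the
  value 1 in degree 0 reappears in degree \<open>j\<close> by symmetry. The pairing excludes socle
  below degree \<open>j\<close>.\<close>

lemma graded_AG_Ann:
  assumes "\<psi> p \<noteq> 0"
  shows "graded_AG Ann" "socle_degree Ann j"
proof -
  have "Ann \<inter> homog 0 = {0}"
  proof (intro equalityI subsetI)
    fix f assume f: "f \<in> Ann \<inter> homog 0"
    then obtain c where c: "f = pscale c 1" using homog_0E by blast
    have "\<psi> (f * p) = 0" using f unfolding Ann_def by blast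
    then have "c = 0" using assms by (simp add: c psi_pscale)
    then show "f \<in> {0}" using c by simp
  qed (simp add: Ann_def)
  moreover have "mp.dim {0 :: ('v, 'k) mpoly} = 0"
    by (rule mp.dim_unique[of "{}"]) (auto simp: mp.independent_empty)
  moreover have "mp.dim (homog 0 :: ('v, 'k) mpoly set) = 1"
  proof (rule mp.dim_unique[of "{1}"])
    show "homog 0 \<subseteq> mp.span {1 :: ('v, 'k) mpoly}"
      by (auto simp: mp.span_singleton elim: homog_0E)
  qed auto
  ultimately have h0: "hilb Ann 0 = 1" by (simp add: hilb_def kdim_def)
  then have hj: "hilb Ann j = 1" using hilb_Ann_sym[of 0] by simp
  have hgt: "hilb Ann d = 0" if "j < d" for d
    using Ann_homog_gt[OF that] hilb_eq_0_iff[OF homog_ideal_Ann] by blast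
  show "socle_degree Ann j" using hj hgt by (simp add: socle_degree_def)
  \<comment> \<open>Multiplying by a variable leads to degree \<open>j + 1\<close>, which lies
    entirely in \<open>Ann\<close>.\<close>
  have sj: "socle_lift Ann j = homog j"
    using Ann_homog_gt[of "Suc j"] homog_var_mult unfolding socle_lift_def by blast
  have "socle_lift Ann d = Ann \<inter> homog d" if "d \<noteq> j" for d
  proof (cases "d < j")
    case True
    then show ?thesis
      using Ann_socle homog_ideal_mult[OF homog_ideal_Ann] unfolding socle_lift_def by blast
  next
    case False
    then have "homog d \<subseteq> Ann" using that Ann_homog_gt[of d] by simp
    then show ?thesis
      using homog_ideal_mult[OF homog_ideal_Ann] unfolding socle_lift_def by blast
  qed
  then have "socle_dim Ann d = (if d = j then 1 else 0)" for d
    using sj hj by (simp add: socle_dim_def hilb_def)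
  then show "graded_AG Ann"
    unfolding graded_AG_def artinian_def using homog_ideal_Ann hgt
    by (auto intro!: exI[of _ "Suc j"])
qed

end

text \<open>The whole piece of degree \<open>j\<close> is socle and nonzero, while the total socle
  dimension is one. So degree \<open>j\<close> uses up the socle and nothing remains in lower
  degrees.\<close>

lemma graded_AG_socle:
  assumes "graded_AG (I :: ('v::finite, 'k::field) mpoly set)" "socle_degree I j"
  shows "hilb I j = 1" "\<And>d. j < d \<Longrightarrow> homog d \<subseteq> I"
    "\<And>d f. d < j \<Longrightarrow> f \<in> homog d \<Longrightarrow> (\<And>v. var v * f \<in> I) \<Longrightarrow> f \<in> I"
proof -
  have I: "homog_ideal I" using assms(1) by (simp add: graded_AG_def)
  show gt: "homog d \<subseteq> I" if "j < d" for d
    using assms(2) that hilb_eq_0_iff[OF I] by (simp add: socle_degree_def)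
  let ?D = "{d. socle_dim I d \<noteq> 0}"
  have D: "(\<Sum>d\<in>?D. socle_dim I d) = 1" "finite ?D"
    using assms(1) by (auto simp: graded_AG_def)
  have "socle_lift I j = homog j"
    using gt[of "Suc j"] homog_var_mult unfolding socle_lift_def by blast
  then have sj: "socle_dim I j = hilb I j" by (simp add: socle_dim_def hilb_def)
  then have jD: "j \<in> ?D" using assms(2) by (simp add: socle_degree_def)
  then have s: "socle_dim I j + (\<Sum>d\<in>?D - {j}. socle_dim I d) = 1"
    using D sum.remove by metis
  then have s': "socle_dim I j = 1" "(\<Sum>d\<in>?D - {j}. socle_dim I d) = 0" using jD by auto
  then show "hilb I j = 1" using sj by simp
  have z: "socle_dim I d = 0" if "d \<noteq> j" for d
  proof (rule ccontr)
    assume "socle_dim I d \<noteq> 0"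
    then have "d \<in> ?D - {j}" using that by simp
    then show False using s'(2) D(2) \<open>socle_dim I d \<noteq> 0\<close> by (meson finite_Diff sum_eq_0_iff)
  qed
  show "f \<in> I" if "d < j" "f \<in> homog d" "\<And>v. var v * f \<in> I" for d f
  proof -
    have "I \<inter> homog d \<subseteq> socle_lift I d" using homog_ideal_mult[OF I] by (auto simp: socle_lift_def)
    moreover have "mp.fin_dim (socle_lift I d)"
      by (rule mp.fin_dim_subset[OF _ fin_dim_homog[of d]]) (auto simp: socle_lift_def)
    moreover have "mp.dim (socle_lift I d) \<le> mp.dim (I \<inter> homog d)"
      using z[of d] that(1) by (simp add: socle_dim_def kdim_def)
    ultimately have "I \<inter> homog d = socle_lift I d"
      using homog_ideal_piece(1)[OF I] by (intro mp.fin_dim_subspace_eq) auto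
    then show ?thesis using that by (auto simp: socle_lift_def)
  qed
qed

text \<open>The ideal has codimension one in degree \<open>j\<close>, so reading off the coefficient
  of \<open>p0\<close> modulo \<open>I\<close> is a functional. The socle condition makes the
  induced pairing perfect, which recovers \<open>I\<close> as its annihilator.\<close>

lemma graded_AG_eq_Ann:
  fixes I :: "('v::finite, 'k::field) mpoly set"
  assumes "graded_AG I" "socle_degree I j" and p0: "p0 \<in> homog j" "p0 \<notin> I"
  obtains \<psi> where "graded_functional \<psi> j" "\<psi> p0 = 1" "I = graded_functional.Ann \<psi>"
proof -
  note soc = graded_AG_socle[OF assms(1,2)]
  have I: "homog_ideal I" using assms(1) by (simp add: graded_AG_def)
  note sub = homog_ideal_subspace[OF I]
  obtain B where B: "B \<subseteq> I \<inter> homog j" "mp.independent B" "finite B" "I \<inter> homog j \<subseteq> mp.span B"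
    "card B = mp.dim (I \<inter> homog j)"
    using mp.fin_dim_basis[OF homog_ideal_piece(2)[OF I]] .
  have spB: "mp.span B \<subseteq> I \<inter> homog j"
    using B(1) homog_ideal_piece(1)[OF I] by (intro mp.span_minimal) auto
  have "p0 \<notin> mp.span B" using spB p0 by blast
  then have ind: "mp.independent (insert p0 B)" and "p0 \<notin> B"
    using B(2) mp.independent_insertI mp.span_base by auto
  then have card: "mp.dim (mp.span (insert p0 B)) = Suc (mp.dim (I \<inter> homog j))"
    using B(3,5) mp.dim_span_eq_card_independent[OF ind] by simp
  \<comment> \<open>\<open>B\<close> spans the degree \<open>j\<close> piece of \<open>I\<close>,
    which has codimension one.\<close>
  have "mp.span (insert p0 B) = homog j"
  proof (rule mp.fin_dim_subspace_eq)
    show "mp.span (insert p0 B) \<subseteq> homog j" using B(1) p0(1) by (intro mp.span_minimal) auto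
    show "mp.dim (homog j :: ('v, 'k) mpoly set) \<le> mp.dim (mp.span (insert p0 B))"
      using soc(1) card by (simp add: hilb_def kdim_def)
  qed auto
  then have ex: "\<exists>c. hcomp j f - pscale c p0 \<in> I" for f
    using hcomp_homog[of j f] spB by (force simp: mp.span_breakdown_eq)
  have uniq: "c = c'" if "hcomp j f - pscale c p0 \<in> I" "hcomp j f - pscale c' p0 \<in> I" for f c c'
  proof (rule ccontr)
    assume "c \<noteq> c'"
    have "(hcomp j f - pscale c' p0) - (hcomp j f - pscale c p0) \<in> I"
      using mp.subspace_diff[OF sub] that by blast
    then have "pscale (c - c') p0 \<in> I" by (simp add: mp.scale_left_diff_distrib)
    then have "pscale (inverse (c - c')) (pscale (c - c') p0) \<in> I" using mp.subspace_scale[OF sub] by blast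
    then show False using p0(2) \<open>c \<noteq> c'\<close> by simp
  qed
  define \<psi> where "\<psi> f = (THE c. hcomp j f - pscale c p0 \<in> I)" for f
  have psi: "hcomp j f - pscale (\<psi> f) p0 \<in> I" for f
    unfolding \<psi>_def by (rule theI') (use ex uniq in blast)
  have psi_eqI: "hcomp j f - pscale c p0 \<in> I \<Longrightarrow> \<psi> f = c" for f c
    using psi uniq by blast
  interpret graded_functional \<psi> j
  proof
    fix f g c
    have "(hcomp j f - pscale (\<psi> f) p0) + (hcomp j g - pscale (\<psi> g) p0) \<in> I"
      using mp.subspace_add[OF sub] psi by blast
    then show "\<psi> (f + g) = \<psi> f + \<psi> g"
      by (intro psi_eqI) (simp add: hcomp_add mp.scale_left_distrib algebra_simps)
    have "pscale c (hcomp j f - pscale (\<psi> f) p0) \<in> I"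
      using mp.subspace_scale[OF sub] psi by blast
    then show "\<psi> (pscale c f) = c * \<psi> f"
      by (intro psi_eqI) (simp add: hcomp_pscale mp.scale_right_diff_distrib)
    show "\<psi> (hcomp j f) = \<psi> f"
      using psi[of f] by (intro psi_eqI) (simp add: hcomp_of_homog[OF hcomp_homog])
  qed
  have zero: "\<psi> f = 0 \<longleftrightarrow> f \<in> I" if "f \<in> homog j" for f
    using psi[of f] psi_eqI[of f 0] hcomp_of_homog[OF that, of j] by auto
  \<comment> \<open>Descending induction on the degree: each \<open>var v * f\<close> again
    satisfies the hypothesis, so it lies in \<open>I\<close>, and then \<open>f\<close> represents a
    socle element below degree \<open>j\<close>.\<close>
  have pair: "f \<in> I" if "d \<le> j" "f \<in> homog d" "\<forall>g\<in>homog (j - d). f * g \<in> I" for f d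
    using that
  proof (induction "j - d" arbitrary: d f)
    case 0
    then show ?case using one_homog by (metis mult.right_neutral)
  next
    case (Suc n)
    show ?case
    proof (rule soc(3))
      show "d < j" "f \<in> homog d" using Suc by auto
      fix v
      show "var v * f \<in> I"
      proof (rule Suc(1)[of "Suc d"])
        show "n = j - Suc d" "Suc d \<le> j" using Suc(2) by auto
        show "var v * f \<in> homog (Suc d)" using Suc by (intro homog_var_mult)
        show "\<forall>g\<in>homog (j - Suc d). var v * f * g \<in> I"
        proof
          fix g :: "('v, 'k) mpoly" assume "g \<in> homog (j - Suc d)"
          then have "var v * g \<in> homog (j - d)"
            using homog_var_mult[of g "j - Suc d" v] Suc(2) by (simp add: Suc_diff_Suc)
          then show "var v * f * g \<in> I" using Suc by (metis mult.left_commute mult.assoc)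
        qed
      qed
    qed
  qed
  have "I \<inter> homog d = Ann \<inter> homog d" for d
  proof (cases "d \<le> j")
    case True
    have "f * g \<in> I \<longleftrightarrow> \<psi> (f * g) = 0" if "f \<in> homog d" "g \<in> homog (j - d)" for f g
      using zero[of "f * g"] homog_mult[OF that] True by simp
    moreover have "f * g \<in> I" if "f \<in> I" for f g
      using homog_ideal_mult[OF I that, of g] by (simp add: mult.commute)
    ultimately show ?thesis using pair[OF True] unfolding Ann_homog[OF True] by blast
  next
    case False
    then show ?thesis using Ann_homog_gt[of d] soc(2)[of d] by auto
  qed
  then have "I = Ann" by (rule homog_ideal_eqI[OF I homog_ideal_Ann])
  moreover have "\<psi> p0 = 1"
    using hcomp_of_homog[OF p0(1), of j] mp.subspace_0[OF sub] by (intro psi_eqI) simp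
  ultimately show ?thesis using that graded_functional_axioms by blast
qed

section \<open>Restriction to a line\<close>

text \<open>Multiplication by a monomial shifts exponents; by linearity it is enough to look at
  monomials.\<close>

lemma lookup_monomial_mult:
  "lookup (Poly_Mapping.single n 1 * f) (n + m) = lookup (f :: ('v, 'k::field) mpoly) m"
proof -
  let ?S = "{f :: ('v, 'k) mpoly. lookup (Poly_Mapping.single n 1 * f) (n + m) = lookup f m}"
  have "mp.subspace ?S"
    by (auto simp: mp.subspace_def lookup_add distrib_left)
  then have "(\<Sum>m\<in>keys f. pscale (lookup f m) (Poly_Mapping.single m 1)) \<in> ?S"
    by (intro mp.subspace_sum mp.subspace_scale)
      (auto simp: mult_single lookup_single when_def)
  then show ?thesis by (simp only: mpoly_sum_monomials[symmetric] mem_Collect_eq)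
qed

lemma monomial_eq_iff [simp]:
  "Poly_Mapping.single m (c::'k::zero_neq_one) = Poly_Mapping.single n c \<longleftrightarrow> m = n \<or> c = 0"
  by (metis lookup_single_eq lookup_single_not_eq single_zero)

lemma independent_monomials:
  "mp.independent ((\<lambda>m :: 'v \<Rightarrow>\<^sub>0 nat. Poly_Mapping.single m (1::'k::field)) ` M)"
  unfolding mp.independent_explicit_finite_subsets
proof (intro allI impI ballI)
  fix A :: "('v, 'k) mpoly set" and u v
  assume A: "A \<subseteq> (\<lambda>m. Poly_Mapping.single m 1) ` M" "finite A"
    and s: "(\<Sum>v\<in>A. pscale (u v) v) = 0" and "v \<in> A"
  then obtain m where m: "v = Poly_Mapping.single m 1" by auto
  have "lookup (\<Sum>v\<in>A. pscale (u v) v) m = (\<Sum>v'\<in>A. if v' = v then u v else 0)"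
    unfolding lookup_sum
  proof (rule sum.cong[OF refl])
    fix x assume "x \<in> A"
    then obtain m' where "x = Poly_Mapping.single m' 1" using A(1) by auto
    then show "lookup (pscale (u x) x) m = (if x = v then u v else 0)"
      by (cases "m' = m") (auto simp: m lookup_single)
  qed
  also have "\<dots> = u v" using \<open>v \<in> A\<close> A(2) by simp
  finally show "u v = 0" using s by simp
qed

lemma dim_homog_1: "mp.dim (homog 1 :: ('v::finite, 'k::field) mpoly set) = card (UNIV :: 'v set)"
proof (rule mp.dim_unique)
  let ?e = "\<lambda>m. Poly_Mapping.single m (1::'k)"
  have M: "{m :: 'v \<Rightarrow>\<^sub>0 nat. mdeg m = 1} = range (\<lambda>v. Poly_Mapping.single v 1)"
  proof (intro equalityI subsetI)
    fix m :: "'v \<Rightarrow>\<^sub>0 nat" assume "m \<in> {m. mdeg m = 1}"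
    then have "mdeg m = Suc 0" by simp
    then obtain v m' where "m = Poly_Mapping.single v 1 + m'" "mdeg m' = 0" by (rule mdeg_SucE)
    then show "m \<in> range (\<lambda>v. Poly_Mapping.single v 1)" by simp
  qed auto
  show "?e ` {m :: 'v \<Rightarrow>\<^sub>0 nat. mdeg m = 1} \<subseteq> homog 1"
    using single_homog[where c = "1::'k"] by (metis (mono_tags, lifting) image_subsetI mem_Collect_eq)
  show "homog 1 \<subseteq> mp.span (?e ` {m :: 'v \<Rightarrow>\<^sub>0 nat. mdeg m = 1})" by (rule homog_subset_span_monomials)
  show "mp.independent (?e ` {m :: 'v \<Rightarrow>\<^sub>0 nat. mdeg m = 1})" by (rule independent_monomials)
  have "inj ?e" by (simp add: inj_on_def)
  moreover have "inj (\<lambda>v::'v. Poly_Mapping.single v (1::nat))"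
    by (simp add: inj_on_def)
  ultimately show "card (?e ` {m :: 'v \<Rightarrow>\<^sub>0 nat. mdeg m = 1}) = card (UNIV :: 'v set)"
    unfolding M by (metis card_image image_image inj_compose inj_on_subset subset_UNIV)
qed

section \<open>Univariate polynomials of bounded degree\<close>

interpretation pv: vector_space "smult :: 'k::field \<Rightarrow> 'k poly \<Rightarrow> 'k poly"
  by unfold_locales (auto simp: smult_add_right smult_add_left)

lemma subspace_degree_le: "pv.subspace {p :: 'k::field poly. degree p \<le> d}"
  by (auto simp: pv.subspace_def degree_add_le intro: order_trans[OF degree_smult_le])

lemma degree_le_basis:
  "pv.independent ((\<lambda>k. monom (1::'k::field) k) ` {..d})"
  "pv.span ((\<lambda>k. monom (1::'k) k) ` {..d}) = {p. degree p \<le> d}"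
proof -
  show span: "pv.span ((\<lambda>k. monom (1::'k) k) ` {..d}) = {p. degree p \<le> d}" for d
  proof
    show "pv.span ((\<lambda>k. monom (1::'k) k) ` {..d}) \<subseteq> {p. degree p \<le> d}"
      by (rule pv.span_minimal[OF _ subspace_degree_le]) (auto simp: degree_monom_eq)
    show "{p. degree p \<le> d} \<subseteq> pv.span ((\<lambda>k. monom (1::'k) k) ` {..d})"
    proof
      fix p :: "'k poly" assume "p \<in> {p. degree p \<le> d}"
      then have "p = (\<Sum>k\<le>d. smult (coeff p k) (monom 1 k))"
        using poly_as_sum_of_monoms'[of p d] by (simp add: smult_monom)
      also have "\<dots> \<in> pv.span ((\<lambda>k. monom (1::'k) k) ` {..d})"
        by (intro pv.span_sum pv.span_scale pv.span_base) auto
      finally show "p \<in> pv.span ((\<lambda>k. monom (1::'k) k) ` {..d})" .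
    qed
  qed
  show "pv.independent ((\<lambda>k. monom (1::'k) k) ` {..d})"
  proof (induction d)
    case 0
    then show ?case by (simp add: pv.dependent_single)
  next
    case (Suc d)
    have "monom (1::'k) (Suc d) \<notin> pv.span ((\<lambda>k. monom 1 k) ` {..d})"
      unfolding span by (simp add: degree_monom_eq)
    then show ?case using Suc by (simp add: atMost_Suc pv.independent_insertI)
  qed
qed

lemma fin_dim_degree_le: "pv.fin_dim {p :: 'k::field poly. degree p \<le> d}"
  unfolding pv.fin_dim_def using degree_le_basis(2)[of d]
  by (metis finite_atMost finite_imageI order_refl)

lemma dim_degree_le: "pv.dim {p :: 'k::field poly. degree p \<le> d} = d + 1"
proof (rule pv.dim_unique)
  show "card ((\<lambda>k. monom (1::'k) k) ` {..d}) = d + 1"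
    by (subst card_image) (auto simp: inj_on_def monom_eq_iff')
qed (use degree_le_basis[of d, where ?'k = 'k] pv.span_superset in \<open>auto simp: degree_monom_eq\<close>)

text \<open>Macaulay's bound in two variables, dehomogenised: without growth \<open>J\<close> would be closed under
  multiplication by the variable and so contain elements of unbounded degree.\<close>

lemma dim_poly_space_growth:
  fixes J J' :: "'k::field poly set"
  assumes J: "pv.subspace J" "J \<subseteq> {p. degree p \<le> d}" "q \<in> J" "q \<noteq> 0"
    and J': "pv.fin_dim J'" "J \<subseteq> J'" "\<And>p. p \<in> J \<Longrightarrow> pCons 0 p \<in> J'"
  shows "pv.dim J + 1 \<le> pv.dim J'"
proof (rule ccontr)
  assume "\<not> ?thesis"
  then have "J = J'" using J(1) J' by (intro pv.fin_dim_subspace_eq) auto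
  have "(pCons 0 ^^ n) q \<in> J \<and> degree ((pCons 0 ^^ n) q) = degree q + n \<and> (pCons 0 ^^ n) q \<noteq> 0" for n
    by (induction n) (use J J'(3) \<open>J = J'\<close> in auto)
  from this[of "Suc d"] show False using J(2) by auto
qed

text \<open>None of the three generators is divisible by \<open>var Z\<close>. This later excludes
  linear forms \<open>f\<close> from the ideal, since \<open>var Z * f\<close> would be such a
  quadric.\<close>

lemma in_kspan_lookup:
  fixes q :: "(var4, 'k::field) mpoly"
  assumes "q \<in> kspan {var W * var W, var W * var X, var W * var Y}"
  shows "lookup q (Poly_Mapping.single Z 1 + Poly_Mapping.single v 1) = 0"
proof -
  let ?S = "{q :: (var4, 'k) mpoly. lookup q (Poly_Mapping.single Z 1 + Poly_Mapping.single v 1) = 0}"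
  have ne: "Poly_Mapping.single W 1 + Poly_Mapping.single u 1
      \<noteq> Poly_Mapping.single Z 1 + Poly_Mapping.single v (1::nat)" if "u \<noteq> Z" for u
  proof
    assume "Poly_Mapping.single W 1 + Poly_Mapping.single u 1
      = Poly_Mapping.single Z 1 + Poly_Mapping.single v (1::nat)"
    from arg_cong[OF this, of "\<lambda>m. lookup m Z"] show False
      using that by (simp add: lookup_add lookup_single)
  qed
  have "mp.subspace ?S" by (auto simp: mp.subspace_def lookup_add)
  moreover have "{var W * var W, var W * var X, var W * var Y} \<subseteq> ?S"
    using ne[of W] ne[of X] ne[of Y] by (simp add: var_def mult_single lookup_single)
  ultimately have "mp.span {var W * var W, var W * var X, var W * var Y} \<subseteq> ?S"
    by (rule mp.span_minimal[rotated])
  then show ?thesis using assms unfolding kspan_def by blast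
qed

text \<open>The coordinates describe \<open>R/(w) = K[x,y,z]\<close> dehomogenised at \<open>x = 1\<close>, as polynomials in \<open>z\<close>
  over \<open>K[y]\<close>; \<open>restr a\<close> further restricts to the line \<open>z = a x\<close>.\<close>

definition coord :: "var4 \<Rightarrow> 'k::field poly poly" where
  "coord v = (case v of W \<Rightarrow> 0 | X \<Rightarrow> 1 | Y \<Rightarrow> [:[:0, 1:]:] | Z \<Rightarrow> [:0, 1:])"

lemma coord_simps: "coord W = 0" "coord X = 1" "coord Y = [:[:0, 1:]:]" "coord Z = [:0, 1:]"
  by (simp_all add: coord_def)

interpretation dehom: mpoly_eval "\<lambda>a::'k::field. [:[:a:]:]" coord
  by unfold_locales (auto simp: one_pCons)

abbreviation dehom :: "(var4, 'k::field) mpoly \<Rightarrow> 'k poly poly" where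
  "dehom \<equiv> dehom.ev"

definition restr :: "'k::field \<Rightarrow> (var4, 'k) mpoly \<Rightarrow> 'k poly" where
  "restr a f = poly (dehom f) [:a:]"

definition lin :: "'k::field \<Rightarrow> (var4, 'k) mpoly" where
  "lin a = var Z - pscale a (var X)"

text \<open>Homogenisation of \<open>p\<close> to a binary form of degree \<open>d\<close>; it is a
  section of \<open>restr a\<close> over the polynomials of degree at most \<open>d\<close>.\<close>

definition binary :: "nat \<Rightarrow> 'k::field poly \<Rightarrow> (var4, 'k) mpoly" where
  "binary d p = (\<Sum>k\<le>d. pscale (coeff p k) (var X ^ (d - k) * var Y ^ k))"

lemma restr_simps [simp]:
  "restr a (f + g) = restr a f + restr a g" "restr a (f - g) = restr a f - restr a g"
  "restr a (f * g) = restr a f * restr a g" "restr a (pscale c f) = smult c (restr a f)"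
  "restr a (f ^ n) = restr a f ^ n"
  "restr a (var W) = 0" "restr a (var X) = 1" "restr a (var Y) = [:0, 1:]" "restr a (var Z) = [:a:]"
  "restr a 0 = 0" "restr a 1 = 1"
  by (simp_all add: restr_def dehom.ev_add dehom.ev_diff dehom.ev_mult dehom.ev_pscale
      dehom.ev_power poly_power coord_simps)

lemma restr_lin [simp]: "restr a (lin a) = 0"
  by (simp add: lin_def one_pCons)

lemma lin_homog: "lin a \<in> homog 1"
  unfolding lin_def by (intro homog_diff homog_pscale) auto

lemma dehom_lin: "dehom (lin a) \<noteq> 0"
proof -
  have "dehom (lin a) = [:[:-a:], 1:]"
    by (simp add: lin_def dehom.ev_diff dehom.ev_pscale coord_simps one_pCons)
  then show ?thesis by simp
qed

lemma restr_sum: "restr a (sum f A) = (\<Sum>x\<in>A. restr a (f x))"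
  by (induction A rule: infinite_finite_induct) auto

lemma restr_binary:
  fixes p :: "'k::field poly"
  assumes "degree p \<le> d"
  shows "restr a (binary d p) = p"
proof -
  have "[:0, 1:] ^ k = monom (1::'k::field) k" for k by (simp add: monom_altdef)
  then have "restr a (binary d p) = (\<Sum>k\<le>d. smult (coeff p k) (monom 1 k))"
    unfolding binary_def restr_sum by simp
  then show ?thesis using poly_as_sum_of_monoms'[OF assms] by (simp add: smult_monom)
qed

lemma binary_0 [simp]: "binary d 0 = 0"
  by (simp add: binary_def)

lemma binary_add: "binary d (p + q) = binary d p + binary d q"
  by (simp add: binary_def mp.scale_left_distrib sum.distrib)

lemma binary_smult: "binary d (smult c p) = pscale c (binary d p)"
  by (simp add: binary_def mp.scale_sum_right)

lemma binary_X:
  assumes "degree p \<le> d"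
  shows "var X * binary d p = binary (Suc d) p"
proof -
  have "coeff p (Suc d) = 0" using assms by (simp add: coeff_eq_0)
  then show ?thesis unfolding binary_def sum_distrib_left
    by (auto simp: Suc_diff_le mult.assoc[symmetric] intro!: sum.cong)
qed

lemma binary_Y: "var Y * binary d p = binary (Suc d) (pCons 0 p)"
proof -
  have "binary (Suc d) (pCons 0 p) = (\<Sum>k\<le>d. pscale (coeff p k) (var X ^ (d - k) * var Y ^ Suc k))"
    unfolding binary_def by (subst sum.atMost_Suc_shift) simp
  then show ?thesis unfolding binary_def sum_distrib_left
    by (auto simp: mult_ac intro!: sum.cong)
qed

text \<open>Modulo \<open>var W\<close> and \<open>lin a\<close> only binary forms in
  \<open>x\<close> and \<open>y\<close> remain. The clause for \<open>d = 0\<close> is there because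
  \<open>d - 1\<close> is then 0 and would admit constants \<open>u\<close>,
  \<open>g\<close>.\<close>

lemma homog_decomp:
  fixes f :: "(var4, 'k::field) mpoly"
  assumes "f \<in> homog d"
  obtains u g p where "f = var W * u + lin a * g + binary d p" "degree p \<le> d"
    "u \<in> homog (d - 1)" "g \<in> homog (d - 1)" "d = 0 \<Longrightarrow> u = 0 \<and> g = 0"
proof -
  define S where "S = (\<lambda>d. {f :: (var4, 'k) mpoly. \<exists>u g p. f = var W * u + lin a * g + binary d p
      \<and> degree p \<le> d \<and> u \<in> homog (d - 1) \<and> g \<in> homog (d - 1) \<and> (d = 0 \<longrightarrow> u = 0 \<and> g = 0)})"
  have SI: "f \<in> S d" if "f = var W * u + lin a * g + binary d p" "degree p \<le> d"
    "u \<in> homog (d - 1)" "g \<in> homog (d - 1)" "d = 0 \<longrightarrow> u = 0 \<and> g = 0" for f u g p d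
    unfolding S_def using that by blast
  have sub: "mp.subspace (S d)" for d
  proof (rule mp.subspaceI)
    show "0 \<in> S d" by (rule SI[of _ 0 0 _ 0]) auto
    fix x y c assume "x \<in> S d" "y \<in> S d"
    then obtain u g p u' g' p' where x: "x = var W * u + lin a * g + binary d p" "degree p \<le> d"
        "u \<in> homog (d - 1)" "g \<in> homog (d - 1)" "d = 0 \<longrightarrow> u = 0 \<and> g = 0"
      and y: "y = var W * u' + lin a * g' + binary d p'" "degree p' \<le> d"
        "u' \<in> homog (d - 1)" "g' \<in> homog (d - 1)" "d = 0 \<longrightarrow> u' = 0 \<and> g' = 0"
      unfolding S_def by blast
    show "x + y \<in> S d"
      by (rule SI[of _ "u + u'" "g + g'" _ "p + p'"])
        (use x y in \<open>auto simp: binary_add distrib_left intro!: degree_add_le homog_add\<close>)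
    show "pscale c x \<in> S d"
      by (rule SI[of _ "pscale c u" "pscale c g" _ "smult c p"])
        (use x in \<open>auto simp: binary_smult mp.scale_right_distrib intro!: homog_pscale
          intro: order_trans[OF degree_smult_le]\<close>)
  qed
  have "homog d \<subseteq> S d" for d
  proof (induction d)
    case 0
    show ?case
    proof
      fix f :: "(var4, 'k) mpoly" assume "f \<in> homog 0"
      then obtain c where "f = pscale c 1" by (rule homog_0E)
      then show "f \<in> S 0" by (intro SI[of _ 0 0 _ "[:c:]"]) (auto simp: binary_def)
    qed
  next
    case (Suc d)
    show ?case
    proof (rule homog_Suc_subset[OF sub])
      fix v and q :: "(var4, 'k) mpoly" assume q: "q \<in> homog d"
      then have "q \<in> S d" using Suc by blast
      then obtain u g p where f: "q = var W * u + lin a * g + binary d p" "degree p \<le> d"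
        "u \<in> homog (d - 1)" "g \<in> homog (d - 1)" "d = 0 \<longrightarrow> u = 0 \<and> g = 0"
        unfolding S_def by blast
      have vh: "var v * u \<in> homog d" "var v * g \<in> homog d" for v
        using f(3-5) homog_var_mult[of u "d - 1" v] homog_var_mult[of g "d - 1" v]
        by (cases d; auto)+
      have bh: "binary d p \<in> homog d"
      proof -
        have "binary d p = q - (var W * u + lin a * g)" using f(1) by simp
        moreover have "lin a * g \<in> homog d"
          using f(4,5) homog_mult[OF lin_homog f(4), of a] by (cases d) auto
        ultimately show ?thesis using q vh by (simp add: homog_add homog_diff)
      qed
      show "var v * q \<in> S (Suc d)"
      proof (cases v)
        case W
        then show ?thesis using q by (intro SI[of _ q 0 _ 0]) auto
      next
        case X
        show ?thesis
          by (rule SI[of _ "var X * u" "var X * g" _ p])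
            (use X f vh in \<open>auto simp: binary_X[symmetric] algebra_simps\<close>)
      next
        case Y
        show ?thesis
          by (rule SI[of _ "var Y * u" "var Y * g" _ "pCons 0 p"])
            (use Y f vh in \<open>auto simp: binary_Y[symmetric] algebra_simps degree_pCons_eq_if\<close>)
      next
        case Z
        \<comment> \<open>Rewriting \<open>z\<close> as \<open>lin a\<close> plus \<open>a x\<close>
          turns multiplication by \<open>z\<close> into multiplication by \<open>a x\<close> on the
          binary part.\<close>
        have "var Z * binary d p = lin a * binary d p + pscale a (var X * binary d p)"
          by (simp add: lin_def algebra_simps)
        also have "\<dots> = lin a * binary d p + binary (Suc d) (smult a p)"
          using f(2) by (simp add: binary_X binary_smult)
        finally have e: "var Z * binary d p = lin a * binary d p + binary (Suc d) (smult a p)" .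
        show ?thesis
        proof (rule SI[of _ "var Z * u" "var Z * g + binary d p" _ "smult a p"])
          show "var v * q = var W * (var Z * u) + lin a * (var Z * g + binary d p) + binary (Suc d) (smult a p)"
            using Z f(1) e by (simp add: distrib_left mult_ac)
          show "degree (smult a p) \<le> Suc d" using f(2) degree_smult_le[of a p] by simp
        qed (use vh bh in \<open>auto simp: homog_add\<close>)
      qed
    qed
  qed
  then have "f \<in> S d" using assms by blast
  then show ?thesis using that unfolding S_def by blast
qed

text \<open>The kernel of restriction is the ideal \<open>(w, lin a)\<close>: \<open>restr a\<close>
  returns the polynomial of the binary part, which must therefore vanish.\<close>

lemma restr_eq_0E:
  fixes f :: "(var4, 'k::field) mpoly"
  assumes "f \<in> homog (Suc d)" "restr a f = 0"
  obtains u g where "f = var W * u + lin a * g" "u \<in> homog d" "g \<in> homog d"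
proof -
  obtain u g p where f: "f = var W * u + lin a * g + binary (Suc d) p" "degree p \<le> Suc d"
    "u \<in> homog (Suc d - 1)" "g \<in> homog (Suc d - 1)"
    using homog_decomp[OF assms(1), of a] by blast
  have "p = 0" using assms(2) f(2) by (simp add: f(1) restr_binary)
  then show ?thesis using that f by simp
qed

lemma degree_restr:
  assumes "f \<in> homog d"
  shows "degree (restr a f) \<le> d"
proof -
  obtain u g p where f: "f = var W * u + lin a * g + binary d p" "degree p \<le> d"
    using homog_decomp[OF assms, of a] by blast
  then show ?thesis by (simp add: restr_binary)
qed

lemma restr_image_homog: "restr a ` homog d = {p. degree p \<le> d}"
proof (intro equalityI subsetI)
  fix p :: "'a poly" assume p: "p \<in> {p. degree p \<le> d}"
  have "binary d p \<in> homog d"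
    unfolding binary_def
  proof (intro mp.subspace_sum[OF subspace_homog] homog_pscale)
    fix k assume "k \<in> {..d}"
    moreover have "var X ^ (d - k) * var Y ^ k \<in> (homog ((d - k) * 1 + k * 1) :: (var4, 'a) mpoly set)"
      by (intro homog_mult homog_power var_homog)
    ultimately show "var X ^ (d - k) * var Y ^ k \<in> (homog d :: (var4, 'a) mpoly set)" by simp
  qed
  then show "p \<in> restr a ` homog d" using restr_binary[of p d a] p by force
qed (use degree_restr in auto)

text \<open>Dehomogenisation loses nothing but \<open>w\<close> on forms of a fixed degree.
  Restricting to \<open>z = 0\<close> writes \<open>f\<close> as \<open>w u + z g\<close>; as
  \<open>K[y][z]\<close> is a domain, \<open>dehom g = 0\<close>, and the degree has
  dropped.\<close>

lemma dehom_eq_0E: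
  fixes f :: "(var4, 'k::field) mpoly"
  assumes "f \<in> homog d" "dehom f = 0"
  obtains u where "f = var W * u" "u \<in> homog (d - 1)" "d = 0 \<Longrightarrow> u = 0"
proof -
  have "\<exists>u. f = var W * u \<and> u \<in> homog (d - 1) \<and> (d = 0 \<longrightarrow> u = 0)"
    using assms
  proof (induction d arbitrary: f)
    case 0
    then obtain c where c: "f = pscale c 1" by (auto elim: homog_0E)
    then have "c = 0" using 0 by (simp add: dehom.ev_pscale)
    then show ?case using c by (intro exI[of _ 0]) simp
  next
    case (Suc d)
    have "restr 0 f = 0" using Suc.prems by (simp add: restr_def)
    then obtain u g where f: "f = var W * u + lin 0 * g" "u \<in> homog d" "g \<in> homog d"
      using restr_eq_0E[OF Suc.prems(1)] by blast
    then have "dehom (lin 0) * dehom g = 0"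
      using Suc.prems(2) by (simp add: dehom.ev_add dehom.ev_mult coord_simps)
    then have "dehom g = 0" using dehom_lin[of "0::'k"] by simp
    then obtain u' where u': "g = var W * u'" "u' \<in> homog (d - 1)" "d = 0 \<longrightarrow> u' = 0"
      using Suc.IH[OF f(3)] by blast
    have "lin 0 * u' \<in> homog d"
      using u'(2,3) homog_mult[OF lin_homog u'(2), of 0] by (cases d) auto
    moreover have "f = var W * (u + lin 0 * u')" by (simp add: f(1) u'(1) algebra_simps)
    ultimately show ?case using f(2) by (auto intro!: exI[of _ "u + lin 0 * u'"] homog_add)
  qed
  then show ?thesis using that by blast
qed

section \<open>First differences of the Hilbert function\<close>

text \<open>Over a finite field, one plus the product of all \<open>X - a\<close> has positive
  degree and no root.\<close>

lemma alg_closed_infinite: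
  assumes "alg_closed TYPE('k::field)"
  shows "infinite (UNIV :: 'k set)"
proof
  assume fin: "finite (UNIV :: 'k set)"
  define q where "q = (\<Prod>a\<in>(UNIV :: 'k set). [:- a, 1:])"
  have q0: "poly q x = 0" for x unfolding q_def poly_prod using fin by (auto intro: prod_zero)
  have "degree q = card (UNIV :: 'k set)"
    unfolding q_def by (subst degree_prod_sum_eq) auto
  then have "degree q > 0" using fin by (simp add: finite_UNIV_card_ge_0)
  then have "degree (q + 1) > 0" by (metis degree_1 degree_add_eq_left)
  then obtain x where "poly (q + 1) x = 0" using assms unfolding alg_closed_def by blast
  then show False using q0 by simp
qed

section \<open>The annihilator ideal with quadratic part w(w,x,y)\<close>

locale wxy_form = graded_functional \<psi> j
  for \<psi> :: "(var4, 'k::field) mpoly \<Rightarrow> 'k" and j +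
  assumes quadrics: "Ann \<inter> homog 2 = kspan {var W * var W, var W * var X, var W * var Y}"
    and nonzero: "\<exists>p. \<psi> p \<noteq> 0"
    and infinite_field: "infinite (UNIV :: 'k set)"
begin

lemma Ann_add: "p \<in> Ann \<Longrightarrow> q \<in> Ann \<Longrightarrow> p + q \<in> Ann"
  and Ann_diff: "p \<in> Ann \<Longrightarrow> q \<in> Ann \<Longrightarrow> p - q \<in> Ann"
  and Ann_pscale: "p \<in> Ann \<Longrightarrow> pscale c p \<in> Ann"
  and Ann_mult: "p \<in> Ann \<Longrightarrow> r * p \<in> Ann"
  and Ann_0: "0 \<in> Ann"
  using homog_ideal_subspace[OF homog_ideal_Ann] homog_ideal_mult[OF homog_ideal_Ann]
  by (auto intro: mp.subspace_add mp.subspace_diff mp.subspace_scale mp.subspace_0)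

lemma psi_Ann: "p \<in> Ann \<Longrightarrow> \<psi> (p * g) = 0"
  unfolding Ann_def by blast

lemma W_mult_mem: "var W * var v \<in> Ann" if "v \<noteq> Z"
proof -
  have "var W * var v \<in> mp.span {var W * var W, var W * var X, var W * var Y}"
    using that by (cases v) (auto intro: mp.span_base)
  then show ?thesis using quadrics unfolding kspan_def by blast
qed

text \<open>For a linear form \<open>f\<close> in the ideal, \<open>var Z * f\<close> is one of its
  quadrics, and those contain no monomial divisible by \<open>z\<close>.\<close>

lemma Ann_homog_1:
  assumes "f \<in> Ann" "f \<in> homog 1"
  shows "f = 0"
proof (rule poly_mapping_eqI)
  fix m
  have "var Z * f \<in> Ann \<inter> homog 2"
    using homog_var_mult[OF assms(2), of Z] Ann_mult[OF assms(1)] by (simp add: numeral_2_eq_2)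
  then have lk: "lookup (var Z * f) (Poly_Mapping.single Z 1 + Poly_Mapping.single v 1) = 0" for v
    using in_kspan_lookup unfolding quadrics by blast
  then have lk': "lookup f (Poly_Mapping.single v 1) = 0" for v
    using lookup_monomial_mult[of "Poly_Mapping.single Z 1" f] unfolding var_def by metis
  show "lookup f m = lookup 0 m"
  proof (cases "mdeg m = 1")
    case True
    then have "mdeg m = Suc 0" by simp
    then obtain v m' where "m = Poly_Mapping.single v 1 + m'" "mdeg m' = 0" by (rule mdeg_SucE)
    then show ?thesis using lk' by simp
  next
    case False
    then show ?thesis using assms(2) by (auto simp: homog_iff)
  qed
qed

lemma hilb_Ann_1: "hilb Ann 1 = 4"
proof -
  have "Ann \<inter> homog 1 = {0}" using Ann_homog_1 Ann_0 by auto
  moreover have "mp.dim {0 :: (var4, 'k) mpoly} = 0"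
    by (rule mp.dim_unique[of "{}"]) (auto simp: mp.independent_empty)
  ultimately show ?thesis
    unfolding hilb_def kdim_def using dim_homog_1[where ?'v = var4 and ?'k = 'k]
    by (simp add: UNIV_var4)
qed

lemma hilb_Ann_0: "hilb Ann 0 = 1"
  using hilb_Ann_sym[of 0] graded_AG_socle(1)[of Ann j] graded_AG_Ann nonzero by auto

text \<open>For \<open>j = 0\<close> everything linear would lie in the ideal, and for
  \<open>j = 1\<close> symmetry would equate the values 1 and 4.\<close>

lemma j_ge_2: "2 \<le> j"
proof (rule ccontr)
  assume "\<not> 2 \<le> j"
  then consider "j = 0" | "j = 1" by linarith
  then show False
  proof cases
    case 1
    then have "homog 1 \<subseteq> Ann" using Ann_homog_gt[of 1] by simp
    then have "hilb Ann 1 = 0" using hilb_eq_0_iff[OF homog_ideal_Ann] by blast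
    then show False using hilb_Ann_1 by simp
  next
    case 2
    then show False using hilb_Ann_sym[of 0] hilb_Ann_0 hilb_Ann_1 by simp
  qed
qed

text \<open>Modulo the ideal \<open>w\<close> is killed by \<open>w\<close>, \<open>x\<close> and
  \<open>y\<close>, so of each form multiplying it only the power of \<open>z\<close>
  survives.\<close>

lemma W_mult_homog:
  assumes "f \<in> homog d"
  obtains c where "var W * f - pscale c (var W * var Z ^ d) \<in> Ann"
proof -
  define S where "S = (\<lambda>d. {f :: (var4, 'k) mpoly. \<exists>c. var W * f - pscale c (var W * var Z ^ d) \<in> Ann})"
  have sub: "mp.subspace (S d)" for d
  proof (rule mp.subspaceI)
    show "0 \<in> S d" unfolding S_def by (auto intro!: exI[of _ 0] simp: Ann_0)
    fix x y c assume "x \<in> S d" "y \<in> S d"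
    then obtain a b where ab: "var W * x - pscale a (var W * var Z ^ d) \<in> Ann"
        "var W * y - pscale b (var W * var Z ^ d) \<in> Ann" unfolding S_def by blast
    have "var W * (x + y) - pscale (a + b) (var W * var Z ^ d) \<in> Ann"
      using Ann_add[OF ab] by (simp add: mp.scale_left_distrib algebra_simps)
    then show "x + y \<in> S d" unfolding S_def by blast
    have "var W * pscale c x - pscale (c * a) (var W * var Z ^ d) \<in> Ann"
      using Ann_pscale[OF ab(1), of c] by (simp add: mp.scale_right_diff_distrib)
    then show "pscale c x \<in> S d" unfolding S_def by blast
  qed
  have "homog d \<subseteq> S d" for d
  proof (induction d)
    case 0
    show ?case
    proof
      fix f :: "(var4, 'k) mpoly" assume "f \<in> homog 0"
      then obtain c where "f = pscale c 1" by (rule homog_0E)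
      then have "var W * f - pscale c (var W * var Z ^ 0) \<in> Ann" by (simp add: Ann_0)
      then show "f \<in> S 0" unfolding S_def by blast
    qed
  next
    case (Suc d)
    show ?case
    proof (rule homog_Suc_subset[OF sub])
      fix v and q :: "(var4, 'k) mpoly" assume q: "q \<in> homog d"
      then obtain c where c: "var W * q - pscale c (var W * var Z ^ d) \<in> Ann"
        using Suc unfolding S_def by blast
      show "var v * q \<in> S (Suc d)"
      proof (cases "v = Z")
        case True
        have "var Z * (var W * q - pscale c (var W * var Z ^ d)) \<in> Ann" by (rule Ann_mult[OF c])
        then have "var W * (var v * q) - pscale c (var W * var Z ^ Suc d) \<in> Ann"
          by (simp add: True right_diff_distrib mult_ac)
        then show ?thesis unfolding S_def by blast
      next
        case False
        have "q * (var W * var v) \<in> Ann" by (rule Ann_mult[OF W_mult_mem[OF False]])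
        then have "var W * (var v * q) - pscale 0 (var W * var Z ^ Suc d) \<in> Ann"
          by (simp add: mult_ac)
        then show ?thesis unfolding S_def by blast
      qed
    qed
  qed
  then show ?thesis using assms that unfolding S_def by blast
qed

text \<open>Otherwise \<open>w z^(j-1)\<close> would lie in the ideal too, so \<open>w\<close> would
  pair to zero with everything of degree \<open>j - 1\<close>. Then \<open>w\<close> itself would be
  a linear form in the ideal.\<close>

lemma W_Z_power_notin:
  assumes "i < j"
  shows "var W * var Z ^ i \<notin> Ann"
proof
  assume mem: "var W * var Z ^ i \<in> Ann"
  have "var Z ^ (j - 1) = var Z ^ (j - 1 - i) * (var Z ^ i :: (var4, 'k) mpoly)"
    unfolding power_add[symmetric] using assms by simp
  then have "var W * var Z ^ (j - 1) = var Z ^ (j - 1 - i) * (var W * var Z ^ i :: (var4, 'k) mpoly)"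
    by (simp only: mult_ac)
  then have mem: "var W * var Z ^ (j - 1) \<in> Ann"
    using Ann_mult[OF mem] by metis
  have "var W \<in> Ann"
  proof -
    have "\<psi> (var W * g) = 0" if g: "g \<in> homog (j - 1)" for g
    proof -
      obtain c where c: "var W * g - pscale c (var W * var Z ^ (j - 1)) \<in> Ann"
        by (rule W_mult_homog[OF g])
      then have "(var W * g - pscale c (var W * var Z ^ (j - 1))) + pscale c (var W * var Z ^ (j - 1)) \<in> Ann"
        by (intro Ann_add Ann_pscale mem)
      then show ?thesis using psi_Ann[of "var W * g" 1] by simp
    qed
    then have "var W \<in> {f \<in> homog 1. \<forall>g\<in>homog (j - 1). \<psi> (f * g) = 0}" by simp
    then show ?thesis using Ann_homog[of 1] assms by auto
  qed
  then have "(var W :: (var4, 'k) mpoly) = 0" by (intro Ann_homog_1) auto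
  then show False by (metis lookup_single_eq lookup_zero var_def zero_neq_one)
qed

text \<open>Integer values, so that first differences may be negative.\<close>

definition hilb_int :: "nat \<Rightarrow> int" where "hilb_int i = int (hilb Ann i)"

lemma hilb_int_alt: "hilb_int i = int (mp.dim (homog i :: (var4, 'k) mpoly set)) - int (mp.dim (Ann \<inter> homog i))"
proof -
  show ?thesis
  using homog_ideal_piece(3)[OF homog_ideal_Ann, of i] unfolding hilb_int_def hilb_def kdim_def by linarith
qed

lemma hilb_int_sym: "i \<le> j \<Longrightarrow> hilb_int i = hilb_int (j - i)"
  using hilb_Ann_sym[of i] unfolding hilb_int_def by simp

text \<open>\<open>mult_rank a m n\<close> is the rank of multiplication by \<open>lin a\<close> from \<open>(R/I)\<^sub>m\<close> to the dual of
  \<open>(R/I)\<^sub>n\<close>, where \<open>m + n + 1 = j\<close>.\<close>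

definition mult_rank :: "'k \<Rightarrow> nat \<Rightarrow> nat \<Rightarrow> int" where
  "mult_rank a m n = int (mp.dim (homog m :: (var4, 'k) mpoly set))
    - int (mp.dim {f \<in> homog m. \<forall>g\<in>homog n. \<psi> (lin a * f * g) = 0})"

lemma mult_rank_sym: "mult_rank a m n = mult_rank a n m"
proof -
  show ?thesis
  using multiplication_rank_sym[where a = m and b = n and p = "lin a"] unfolding mult_rank_def by linarith
qed

text \<open>The degree \<open>i\<close> dimension of the image of the ideal in
  \<open>R/(w, lin a)\<close>, a polynomial ring in two variables.\<close>

definition restr_dim :: "'k \<Rightarrow> nat \<Rightarrow> int" where
  "restr_dim a i = int (pv.dim (restr a ` (Ann \<inter> homog i)))"

lemma linear_restr: "Vector_Spaces.linear pscale smult (restr a)"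
  unfolding Vector_Spaces.linear_iff using mp.vector_space_axioms pv.vector_space_axioms by simp

interpretation vp: vector_space_pair "pscale :: 'k \<Rightarrow> (var4, 'k) mpoly \<Rightarrow> (var4, 'k) mpoly" "smult :: 'k \<Rightarrow> 'k poly \<Rightarrow> 'k poly"
  by (intro vector_space_pair.intro mp.vector_space_axioms pv.vector_space_axioms)

text \<open>What survives modulo \<open>(w, lin a)\<close> contributes
  \<open>i + 1 - restr_dim a i\<close>; the rest is the image of \<open>(w, lin a)\<close> modulo
  the ideal. Since \<open>i \<ge> 2\<close>, multiples of \<open>w\<close> there are already
  multiples of \<open>lin a\<close>, so the rest is the rank of multiplication by
  \<open>lin a\<close>.\<close>

lemma hilb_int_eq:
  assumes "2 \<le> i" "i \<le> j"
  shows "hilb_int i = int i + 1 - restr_dim a i + mult_rank a (j - i) (i - 1)"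
proof -
  let ?K = "{f \<in> homog i. restr a f = 0}"
  let ?R = "homog (j - i) :: (var4, 'k) mpoly set"
  have subK: "mp.subspace ?K"
    using subspace_homog[of i] by (auto simp: mp.subspace_def)
  have finK: "mp.fin_dim ?K" by (rule mp.fin_dim_subset[OF _ fin_dim_homog[of i]]) auto
  have 1: "mp.dim (homog i :: (var4, 'k) mpoly set) = (i + 1) + mp.dim ?K"
    using vp.dim_image_plus_dim_kernel[OF linear_restr[of a] subspace_homog[of i] fin_dim_homog]
    unfolding restr_image_homog dim_degree_le .
  have 2: "int (mp.dim (Ann \<inter> homog i)) = restr_dim a i + int (mp.dim {f \<in> Ann \<inter> homog i. restr a f = 0})"
    using vp.dim_image_plus_dim_kernel[OF linear_restr[of a] homog_ideal_piece(1,2)[OF homog_ideal_Ann, of i]]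
    unfolding restr_dim_def by linarith
  have 3: "mp.dim ?R + mp.dim {f \<in> ?K. \<forall>g\<in>?R. \<psi> (f * g) = 0}
      = mp.dim ?K + mp.dim {g \<in> ?R. \<forall>f\<in>?K. \<psi> (f * g) = 0}"
    by (rule mp.bilinear_rank_sym[OF subK finK])
      (simp_all add: psi_add psi_pscale distrib_left distrib_right)
  have 4: "{f \<in> ?K. \<forall>g\<in>?R. \<psi> (f * g) = 0} = {f \<in> Ann \<inter> homog i. restr a f = 0}"
    unfolding Ann_homog[OF assms(2)] by auto
  \<comment> \<open>Orthogonality to all of \<open>(w, lin a)\<close> in degree \<open>i\<close>
    reduces to orthogonality to the multiples of \<open>lin a\<close>.\<close>
  have 5: "{g \<in> ?R. \<forall>f\<in>?K. \<psi> (f * g) = 0} = {g \<in> ?R. \<forall>f\<in>homog (i - 1). \<psi> (lin a * g * f) = 0}"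
  proof (intro Collect_cong conj_cong refl iffI ballI)
    fix g f :: "(var4, 'k) mpoly"
    assume g: "\<forall>f\<in>?K. \<psi> (f * g) = 0" and f: "f \<in> homog (i - 1)"
    have "lin a * f \<in> homog i" using homog_mult[OF lin_homog f, of a] assms by simp
    then have "lin a * f \<in> ?K" by simp
    then have "\<psi> (lin a * f * g) = 0" using g by blast
    then show "\<psi> (lin a * g * f) = 0" by (simp add: mult_ac)
  next
    fix g f :: "(var4, 'k) mpoly"
    assume g: "\<forall>f\<in>homog (i - 1). \<psi> (lin a * g * f) = 0" and f: "f \<in> ?K"
    have i: "i = Suc (i - 1)" using assms by simp
    obtain u f' where f': "f = var W * u + lin a * f'" "u \<in> homog (i - 1)" "f' \<in> homog (i - 1)"
      by (rule restr_eq_0E[of f "i - 1" a]) (use f i in auto)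
    obtain c where c: "var W * u - pscale c (var W * var Z ^ (i - 1)) \<in> Ann"
      by (rule W_mult_homog[OF f'(2)])
    \<comment> \<open>This \<open>e\<close> gives \<open>w z^(i-1) = lin a * e + a x e\<close>,
      where \<open>x e\<close> is a multiple of \<open>w x\<close> and so lies in the ideal. The
      exponent requires \<open>i \<ge> 2\<close>.\<close>
    define e :: "(var4, 'k) mpoly" where "e = var W * var Z ^ (i - 2)"
    have ie: "i - 1 = Suc (i - 2)" using assms by simp
    have e: "e \<in> homog (i - 1)"
      unfolding e_def ie using homog_power[OF var_homog(1), of Z "i - 2"]
      by (intro homog_var_mult) simp
    have "var Z ^ (i - 2) * (var W * var X) \<in> Ann" using Ann_mult W_mult_mem by blast
    then have "pscale (c * a) (var X * e) \<in> Ann" unfolding e_def by (intro Ann_pscale) (simp add: mult_ac)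
    moreover have "var W * var Z ^ (i - 1) = lin a * e + pscale a (var X * e)"
      unfolding ie e_def lin_def by (simp add: algebra_simps)
    ultimately have "var W * u - pscale c (lin a * e) \<in> Ann"
      using Ann_add[OF c, of "pscale (c * a) (var X * e)"] by (simp add: mp.scale_right_distrib)
    then have "\<psi> ((var W * u - pscale c (lin a * e)) * g) = 0" by (rule psi_Ann)
    moreover have "\<psi> (lin a * g * e) = 0" "\<psi> (lin a * g * f') = 0" using g e f' by auto
    moreover have "f * g = (var W * u - pscale c (lin a * e)) * g + pscale c (lin a * g * e) + lin a * g * f'"
      by (simp add: f'(1) algebra_simps)
    ultimately show "\<psi> (f * g) = 0" by (simp only: psi_add psi_pscale) simp
  qed
  have "mult_rank a (j - i) (i - 1) = int (mp.dim ?R) - int (mp.dim {g \<in> ?R. \<forall>f\<in>?K. \<psi> (f * g) = 0})"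
    unfolding mult_rank_def 5 ..
  then show ?thesis using 1 2 3 unfolding hilb_int_alt 4 by linarith
qed

text \<open>The number \<open>i + 1 - restr_dim a i\<close> is the value at \<open>i\<close> of the Hilbert function of
  \<open>R/(I, w, lin a)\<close>.\<close>

lemma hilb_int_diff:
  assumes "2 \<le> i" "i + 1 \<le> j"
  shows "hilb_int i - hilb_int (i - 1) = (int i + 1 - restr_dim a i) - (int (j + 1 - i) + 1 - restr_dim a (j + 1 - i))"
proof -
  have e: "j - (j + 1 - i) = i - 1" "j + 1 - i - 1 = j - i" "j - (i - 1) = j + 1 - i" using assms by auto
  have "hilb_int (i - 1) = hilb_int (j + 1 - i)" using hilb_int_sym[of "i - 1"] assms e by simp
  \<comment> \<open>Degrees \<open>i\<close> and \<open>j + 1 - i\<close> involve the same two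
    degrees for the multiplication rank, in opposite order, so the ranks cancel.\<close>
  then show ?thesis
    using hilb_int_eq[of i a] hilb_int_eq[of "j + 1 - i" a] assms mult_rank_sym[of a "i - 1" "j - i"] e by simp
qed

text \<open>Up to degree \<open>i\<close> the ideal lies in \<open>(w)\<close>, so its restriction
  vanishes there. Multiplication by \<open>z\<close> is injective from degree \<open>i - 1\<close>
  modulo the ideal, so its rank is the full \<open>hilb_int (i - 1)\<close>.\<close>

lemma hilb_int_diff_initial:
  assumes "2 \<le> i" "i \<le> j" and ini: "\<And>d f. d \<le> i \<Longrightarrow> f \<in> Ann \<inter> homog d \<Longrightarrow> dehom f = 0"
  shows "hilb_int i - hilb_int (i - 1) = int i + 1"
proof -
  have "restr 0 ` (Ann \<inter> homog i) = {0}"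
    using ini[of i] Ann_0 by (force simp: restr_def)
  moreover have "pv.dim {0 :: 'k poly} = 0"
    by (rule pv.dim_unique[of "{}"]) (auto simp: pv.independent_empty)
  ultimately have J: "restr_dim 0 i = 0" by (simp add: restr_dim_def)
  have "{f \<in> homog (i - 1). \<forall>g\<in>homog (j - i). \<psi> (lin 0 * f * g) = 0} = Ann \<inter> homog (i - 1)"
  proof (intro equalityI subsetI)
    fix f assume f: "f \<in> {f \<in> homog (i - 1). \<forall>g\<in>homog (j - i). \<psi> (lin 0 * f * g) = 0}"
    have Lf: "lin 0 * f \<in> homog i" using homog_mult[OF lin_homog, of f "i - 1" 0] f assms by simp
    then have "lin 0 * f \<in> {f \<in> homog i. \<forall>g\<in>homog (j - i). \<psi> (f * g) = 0}" using f by blast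
    then have LA: "lin 0 * f \<in> Ann" using Ann_homog[OF assms(2)] by blast
    then have "dehom (lin 0 * f) = 0" using ini[of i] Lf by blast
    then have "dehom f = 0" using dehom_lin[of "0::'k"] by (simp add: dehom.ev_mult)
    \<comment> \<open>Modulo the ideal \<open>f\<close> is now \<open>c w z^(i-2)\<close>.
      Multiplying by \<open>z\<close> puts \<open>c w z^(i-1)\<close> into the ideal, and
      \<open>i - 1 < j\<close> forces \<open>c = 0\<close>.\<close>
    then obtain u where u: "f = var W * u" "u \<in> homog (i - 1 - 1)"
      using f by (blast elim: dehom_eq_0E)
    have "i - 1 - 1 = i - 2" by simp
    then obtain c where c: "var W * u - pscale c (var W * var Z ^ (i - 2)) \<in> Ann"
      using W_mult_homog[OF u(2)] by metis
    have ie: "i - 1 = Suc (i - 2)" using assms by simp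
    have "lin 0 * f - lin 0 * (var W * u - pscale c (var W * var Z ^ (i - 2))) \<in> Ann"
      using Ann_diff[OF LA Ann_mult[OF c]] .
    then have "pscale c (var W * var Z ^ (i - 1)) \<in> Ann"
      unfolding u(1) ie by (simp add: lin_def algebra_simps)
    then have "pscale (inverse c) (pscale c (var W * var Z ^ (i - 1))) \<in> Ann" by (rule Ann_pscale)
    moreover have "i - 1 < j" using assms by linarith
    ultimately have "c = 0" using W_Z_power_notin[of "i - 1"] by (cases "c = 0") auto
    then show "f \<in> Ann \<inter> homog (i - 1)" using c f u(1) by simp
  next
    fix f assume f: "f \<in> Ann \<inter> homog (i - 1)"
    then have "lin 0 * f \<in> Ann" using Ann_mult by blast
    then show "f \<in> {f \<in> homog (i - 1). \<forall>g\<in>homog (j - i). \<psi> (lin 0 * f * g) = 0}"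
      using f psi_Ann by blast
  qed
  then have "mult_rank 0 (i - 1) (j - i) = hilb_int (i - 1)" unfolding mult_rank_def hilb_int_alt by simp
  then show ?thesis using hilb_int_eq[OF assms(1,2), of 0] J mult_rank_sym[of 0 "i - 1" "j - i"] by simp
qed

lemma fin_dim_restr_Ann: "pv.fin_dim (restr a ` (Ann \<inter> homog i))"
  using degree_restr by (intro pv.fin_dim_subset[OF _ fin_dim_degree_le[of i]]) auto

lemma subspace_restr_Ann: "pv.subspace (restr a ` (Ann \<inter> homog i))"
proof -
  interpret l: Vector_Spaces.linear pscale smult "restr a" by (rule linear_restr)
  show ?thesis by (rule l.subspace_image[OF homog_ideal_piece(1)[OF homog_ideal_Ann]])
qed

lemma restr_dim_le: "0 \<le> restr_dim a i" "restr_dim a i \<le> int i + 1"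
proof -
  have "pv.dim (restr a ` (Ann \<inter> homog i)) \<le> pv.dim {p :: 'k poly. degree p \<le> i}"
    by (rule pv.fin_dim_dim_le[OF _ fin_dim_degree_le]) (use degree_restr in auto)
  then show "0 \<le> restr_dim a i" "restr_dim a i \<le> int i + 1" by (auto simp: restr_dim_def dim_degree_le)
qed

text \<open>Multiplication by \<open>x\<close> does not change the restriction and multiplication by
  \<open>y\<close> acts as \<open>pCons 0\<close>, so consecutive images satisfy the hypotheses of
  \<open>dim_poly_space_growth\<close>.\<close>

lemma restr_dim_growth:
  assumes "f \<in> Ann \<inter> homog t" "restr a f \<noteq> 0" "t \<le> i"
  shows "restr_dim a i + 1 \<le> restr_dim a (Suc i)"
proof -
  have "pv.dim (restr a ` (Ann \<inter> homog i)) + 1 \<le> pv.dim (restr a ` (Ann \<inter> homog (Suc i)))"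
  proof (rule dim_poly_space_growth[OF subspace_restr_Ann])
    show "restr a ` (Ann \<inter> homog i) \<subseteq> {p. degree p \<le> i}" using degree_restr by auto
    have "var X ^ (i - t) * f \<in> homog ((i - t) * 1 + t)"
      using assms by (intro homog_mult homog_power) auto
    then have "var X ^ (i - t) * f \<in> Ann \<inter> homog i" using assms Ann_mult by simp
    from imageI[OF this, of "restr a"] show "restr a f \<in> restr a ` (Ann \<inter> homog i)" by simp
    have mem: "var v * g \<in> Ann \<inter> homog (Suc i)" if "g \<in> Ann \<inter> homog i" for v g
      using that Ann_mult homog_var_mult by blast
    show "restr a ` (Ann \<inter> homog i) \<subseteq> restr a ` (Ann \<inter> homog (Suc i))"
    proof
      fix p assume "p \<in> restr a ` (Ann \<inter> homog i)"
      then obtain g where g: "p = restr a g" "g \<in> Ann \<inter> homog i" by blast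
      from imageI[OF mem[OF g(2), of X], of "restr a"] show "p \<in> restr a ` (Ann \<inter> homog (Suc i))"
        using g by simp
    qed
    fix p assume "p \<in> restr a ` (Ann \<inter> homog i)"
    then obtain g where g: "p = restr a g" "g \<in> Ann \<inter> homog i" by blast
    from imageI[OF mem[OF g(2), of Y], of "restr a"] show "pCons 0 p \<in> restr a ` (Ann \<inter> homog (Suc i))"
      using g by simp
  qed (use assms fin_dim_restr_Ann in auto)
  then show ?thesis by (simp add: restr_dim_def)
qed

text \<open>Here \<open>t\<close> is the least degree in which the ideal leaves \<open>(w)\<close>.
  Monotonicity of \<open>i + 1 - restr_dim a i\<close> from \<open>t\<close> on transfers to the
  first differences by \<open>hilb_int_diff\<close>.\<close>

theorem hilb_int_shape:
  obtains t where "3 \<le> t" "\<And>i. 2 \<le> i \<Longrightarrow> i < t \<Longrightarrow> i \<le> j \<Longrightarrow> hilb_int i - hilb_int (i - 1) = int i + 1"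
    "\<And>i. t \<le> Suc i \<Longrightarrow> Suc i \<le> j div 2 \<Longrightarrow> hilb_int (Suc i) - hilb_int i \<le> hilb_int i - hilb_int (i - 1)"
    "\<And>i. 2 \<le> i \<Longrightarrow> i \<le> j div 2 \<Longrightarrow> 0 \<le> hilb_int i - hilb_int (i - 1)"
proof -
  define P where "P t \<longleftrightarrow> (\<exists>f\<in>Ann \<inter> homog t. dehom f \<noteq> 0)" for t
  \<comment> \<open>The power of \<open>x\<close> of degree \<open>j + 1\<close> lies in the ideal
    and not in \<open>(w)\<close>, so a least such degree exists.\<close>
  have "P (Suc j)"
  proof -
    have "var X ^ Suc j \<in> (homog (Suc j * 1) :: (var4, 'k) mpoly set)" by (intro homog_power) simp
    then have "var X ^ Suc j \<in> Ann \<inter> homog (Suc j)" using Ann_homog_gt[of "Suc j"] by auto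
    moreover have "dehom (var X ^ Suc j :: (var4, 'k) mpoly) = 1" by (simp only: dehom.ev_power dehom.ev_var coord_simps power_one)
    ultimately show ?thesis unfolding P_def by (metis zero_neq_one)
  qed
  define t where "t = (LEAST t. P t)"
  have Pt: "P t" unfolding t_def by (rule LeastI[of P, OF \<open>P (Suc j)\<close>])
  have ini: "dehom f = 0" if "d < t" "f \<in> Ann \<inter> homog d" for d f
    using not_less_Least[of d P] that unfolding t_def P_def by blast
  obtain f0 where f0: "f0 \<in> Ann \<inter> homog t" "dehom f0 \<noteq> 0" using Pt unfolding P_def by blast
  \<comment> \<open>A nonzero polynomial in \<open>z\<close> over \<open>K[y]\<close> has finitely
    many roots, while the constants from the infinite field \<open>K\<close> are infinitely many
    candidates.\<close>
  have "\<exists>a. restr a f0 \<noteq> 0"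
  proof (rule ccontr)
    assume "\<not> (\<exists>a. restr a f0 \<noteq> 0)"
    then have "range (\<lambda>a. [:a:]) \<subseteq> {x. poly (dehom f0) x = 0}" by (auto simp: restr_def)
    then have "finite (range (\<lambda>a::'k. [:a:]))" using poly_roots_finite[OF f0(2)] finite_subset by blast
    then show False using infinite_field by (simp add: finite_image_iff inj_on_def)
  qed
  then obtain a where a: "restr a f0 \<noteq> 0" by blast
  have t3: "3 \<le> t"
  proof (rule ccontr)
    assume "\<not> 3 \<le> t"
    then consider "t = 0" | "t = 1" | "t = 2" by linarith
    then show False
    proof cases
      case 1
      then obtain c where c: "f0 = pscale c 1" using f0(1) by (auto elim: homog_0E)
      have "var W * f0 \<in> Ann" using f0(1) Ann_mult by blast
      then have "pscale c (var W * var Z ^ 0) \<in> Ann" by (simp add: c)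
      then have "pscale (inverse c) (pscale c (var W * var Z ^ 0)) \<in> Ann" by (rule Ann_pscale)
      then have "c = 0" using W_Z_power_notin[of 0] j_ge_2 by (cases "c = 0") auto
      then show False using c f0(2) by simp
    next
      case 2
      then have "f0 = 0" using f0(1) by (intro Ann_homog_1) auto
      then show False using f0(2) by simp
    next
      case 3
      have "mp.subspace {f :: (var4, 'k) mpoly. dehom f = 0}"
        by (auto simp: mp.subspace_def dehom.ev_add dehom.ev_pscale)
      then have "mp.span {var W * var W, var W * var X, var W * var Y} \<subseteq> {f :: (var4, 'k) mpoly. dehom f = 0}"
        by (rule mp.span_minimal[rotated]) (simp add: dehom.ev_mult coord_simps)
      then show False using f0 3 quadrics unfolding kspan_def by blast
    qed
  qed
  note grow = restr_dim_growth[OF f0(1) a]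
  have J1: "1 \<le> restr_dim a t"
  proof -
    have "restr a ` (Ann \<inter> homog t) \<noteq> {0}" using f0 a by blast
    moreover have "pv.span {} = {0 :: 'k poly}" by simp
    ultimately have "pv.dim (restr a ` (Ann \<inter> homog t)) \<noteq> 0"
      using pv.fin_dim_basis[OF fin_dim_restr_Ann, of a t] f0(1) a
      by (metis card_0_eq imageI singletonD subsetD)
    then show ?thesis by (simp add: restr_dim_def)
  qed
  have c_mono: "int n + 1 - restr_dim a n \<le> int m + 1 - restr_dim a m" if "t \<le> m" "m \<le> n" for m n
    using that(2)
  proof (induction n rule: dec_induct)
    case (step n)
    then show ?case using grow[of n] that by simp
  qed simp
  have init: "hilb_int i - hilb_int (i - 1) = int i + 1" if "2 \<le> i" "i < t" "i \<le> j" for i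
  proof (rule hilb_int_diff_initial[OF that(1,3)])
    fix d f assume "d \<le> i" "f \<in> Ann \<inter> homog d"
    then show "dehom f = 0" using ini[of d f] \<open>i < t\<close> by linarith
  qed
  show ?thesis
  proof (rule that[OF t3 init])
    fix i assume i: "t \<le> Suc i" "Suc i \<le> j div 2"
    then have "2 * i + 2 \<le> j" by linarith
    show "hilb_int (Suc i) - hilb_int i \<le> hilb_int i - hilb_int (i - 1)"
    proof (cases "t = Suc i")
      case True
      have "hilb_int (Suc i) - hilb_int i = (int (Suc i) + 1 - restr_dim a (Suc i)) - (int (j - i) + 1 - restr_dim a (j - i))"
        using hilb_int_diff[of "Suc i" a] i t3 \<open>2 * i + 2 \<le> j\<close> by simp
      \<comment> \<open>At the boundary \<open>t = i + 1\<close> the first bracket is at most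
        \<open>t\<close> because \<open>f0\<close> restricts to something nonzero, and the
        subtracted bracket is nonnegative.\<close>
      also have "\<dots> \<le> int i + 1" using J1 True restr_dim_le(2)[of a "j - i"] by simp
      also have "\<dots> = hilb_int i - hilb_int (i - 1)" using init[of i] True t3 \<open>2 * i + 2 \<le> j\<close> by simp
      finally show ?thesis .
    next
      case False
      then have ti: "t \<le> i" using i by simp
      have "hilb_int (Suc i) - hilb_int i = (int (Suc i) + 1 - restr_dim a (Suc i)) - (int (j - i) + 1 - restr_dim a (j - i))"
        using hilb_int_diff[of "Suc i" a] i t3 \<open>2 * i + 2 \<le> j\<close> by simp
      moreover have "hilb_int i - hilb_int (i - 1) = (int i + 1 - restr_dim a i) - (int (j + 1 - i) + 1 - restr_dim a (j + 1 - i))"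
        using hilb_int_diff[of i a] ti t3 \<open>2 * i + 2 \<le> j\<close> by simp
      moreover have "int (Suc i) + 1 - restr_dim a (Suc i) \<le> int i + 1 - restr_dim a i" using c_mono[of i "Suc i"] ti by simp
      moreover have "int (j + 1 - i) + 1 - restr_dim a (j + 1 - i) \<le> int (j - i) + 1 - restr_dim a (j - i)"
        using c_mono[of "j - i" "j + 1 - i"] ti \<open>2 * i + 2 \<le> j\<close> by simp
      ultimately show ?thesis by linarith
    qed
  next
    fix i assume i: "2 \<le> i" "i \<le> j div 2"
    then have "2 * i \<le> j" by linarith
    show "0 \<le> hilb_int i - hilb_int (i - 1)"
    proof (cases "i < t")
      case True
      then show ?thesis using init[of i] i \<open>2 * i \<le> j\<close> by simp
    next
      case False
      \<comment> \<open>From \<open>2 * i \<le> j\<close> the complementary degree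
        \<open>j + 1 - i\<close> lies above \<open>i\<close>.\<close>
      then have "int (j + 1 - i) + 1 - restr_dim a (j + 1 - i) \<le> int i + 1 - restr_dim a i"
        using \<open>2 * i \<le> j\<close> by (intro c_mono) auto
      then show ?thesis using hilb_int_diff[of i a] i \<open>2 * i \<le> j\<close> by simp
    qed
  qed
qed

end

section \<open>Macaulay growth\<close>

text \<open>The top \<open>c\<close> binomials are \<open>i choose i = 1\<close>, the remaining ones
  \<open>(i - 1) choose i = 0\<close>.\<close>

lemma macaulay_rep_le:
  assumes "c \<le> d"
  shows "macaulay_rep c d (\<lambda>i. if i \<le> d - c then i - 1 else i)"
proof -
  have "(\<Sum>i=1..d. (if i \<le> d - c then i - 1 else i) choose i) = (\<Sum>i\<in>{d - c<..d}. 1)"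
    by (rule sum.mono_neutral_cong_right) (auto simp: binomial_eq_0)
  also have "\<dots> = c" using assms by simp
  finally show ?thesis by (auto simp: macaulay_rep_def)
qed

lemma macaulay_rep_Suc:
  assumes "1 \<le> d"
  shows "macaulay_rep (Suc d) d (\<lambda>i. if i = d then Suc d else i - 1)"
proof -
  have "(\<Sum>i=1..d. (if i = d then Suc d else i - 1) choose i) = (\<Sum>i=1..d. if i = d then Suc d else 0)"
    by (rule sum.cong) (auto simp: binomial_eq_0)
  then show ?thesis using assms by (auto simp: macaulay_rep_def)
qed

text \<open>Pascal's rule splits the shifted binomials into \<open>c\<close> and a remainder. The
  result concerns whichever representation \<open>SOME\<close> selects; \<open>k0\<close> witnesses
  that there is one.\<close>

lemma mac_powE:
  assumes "macaulay_rep c d k0" "c > 0"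
  obtains k where "macaulay_rep c d k" "mac_pow c d = c + (\<Sum>i=1..d. k i choose (i + 1))"
proof -
  define k where "k = (SOME k. macaulay_rep c d k)"
  have k: "macaulay_rep c d k" unfolding k_def by (rule someI[of _ k0]) (rule assms)
  have "mac_pow c d = (\<Sum>i=1..d. (k i + 1) choose (i + 1))"
    using assms(2) by (simp add: mac_pow_def k_def Let_def)
  also have "\<dots> = (\<Sum>i=1..d. k i choose i) + (\<Sum>i=1..d. k i choose (i + 1))"
    by (simp add: sum.distrib)
  also have "(\<Sum>i=1..d. k i choose i) = c" using k by (simp add: macaulay_rep_def)
  finally show ?thesis by (rule that[OF k])
qed

lemma mac_pow_ge:
  assumes "macaulay_rep c d k"
  shows "c \<le> mac_pow c d"
proof (cases "c = 0")
  case False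
  then show ?thesis using mac_powE[OF assms] by (metis le_add1 neq0_conv)
qed simp

text \<open>In a sum of \<open>d\<close> binomials equal to \<open>d + 1\<close> some
  \<open>k i\<close> exceeds \<open>i\<close>, and that index adds at least one to the
  remainder.\<close>

lemma mac_pow_Suc_ge:
  assumes "1 \<le> d"
  shows "d + 2 \<le> mac_pow (Suc d) d"
proof -
  obtain k where k: "macaulay_rep (Suc d) d k" "mac_pow (Suc d) d = Suc d + (\<Sum>i=1..d. k i choose (i + 1))"
    using mac_powE[OF macaulay_rep_Suc[OF assms]] by blast
  have "\<exists>i\<in>{1..d}. i < k i"
  proof (rule ccontr)
    assume "\<not> ?thesis"
    then have "(\<Sum>i=1..d. k i choose i) \<le> (\<Sum>i=1..d. 1)"
      by (intro sum_mono) (metis binomial_eq_0 binomial_n_n le_less linorder_not_less order_refl zero_le_one)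
    then show False using k(1) by (simp add: macaulay_rep_def)
  qed
  then obtain i where i: "i \<in> {1..d}" "i < k i" by blast
  then have "1 \<le> k i choose (i + 1)" by (simp add: Suc_le_eq zero_less_binomial)
  also have "\<dots> \<le> (\<Sum>i=1..d. k i choose (i + 1))"
    using i by (intro member_le_sum) auto
  finally show ?thesis using k(2) by simp
qed

text \<open>The sequence runs 1, 3, 3, 4, ..., \<open>t\<close> and then never increases, as far as
  \<open>s\<close> allows. While it rises its value in degree \<open>d\<close> is
  \<open>d + 1\<close>, which may grow to \<open>d + 2\<close>; from degree \<open>t\<close> on the
  value is at most the degree, and staying constant is allowed.\<close>

lemma O_seq_of_shape:
  fixes b :: "nat \<Rightarrow> int"
  assumes b0: "b 0 = 1" and b1: "1 \<le> s \<Longrightarrow> b 1 = 3" and t: "3 \<le> t"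
    and init: "\<And>i. 2 \<le> i \<Longrightarrow> i < t \<Longrightarrow> i \<le> s \<Longrightarrow> b i = int i + 1"
    and decr: "\<And>i. t \<le> Suc i \<Longrightarrow> Suc i \<le> s \<Longrightarrow> b (Suc i) \<le> b i"
    and nonneg: "\<And>i. 2 \<le> i \<Longrightarrow> i \<le> s \<Longrightarrow> 0 \<le> b i"
  shows "O_seq (map b [0..<s + 1])"
proof -
  have nth: "map b [0..<s + 1] ! i = b i" if "i \<le> s" for i
    using that by (simp del: upt_Suc)
  have pos: "0 \<le> b i" if "i \<le> s" for i
  proof -
    consider "i = 0" | "i = 1" | "2 \<le> i" by linarith
    then show ?thesis using b0 b1 nonneg that by cases auto
  qed
  have le_t: "b i \<le> int t" if "t \<le> Suc i" "i \<le> s" for i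
    using that
  proof (induction i)
    case (Suc i)
    show ?case
    proof (cases "t \<le> Suc i")
      case True
      then show ?thesis using Suc decr[of i] by simp
    next
      case False
      then show ?thesis using Suc init[of "Suc i"] t by simp
    qed
  qed (use t in simp)
  have growth: "b (d + 1) \<le> int (mac_pow (nat (b d)) d)" if d: "1 \<le> d" "d + 1 \<le> s" for d
  proof -
    consider "d = 1" | "2 \<le> d" "d < t" | "t \<le> d" using d by linarith
    then show ?thesis
    proof cases
      case 1
      have "macaulay_rep 3 1 (\<lambda>_. 3)" by (simp add: macaulay_rep_def)
      from mac_pow_ge[OF this] show ?thesis using 1 d b1 init[of 2] t by (simp add: numeral_2_eq_2)
    next
      case 2
      have "b (d + 1) \<le> int d + 2"
      proof (cases "d + 1 < t")
        case True
        then show ?thesis using init[of "d + 1"] 2 d by simp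
      next
        case False
        then show ?thesis using le_t[of "d + 1"] d 2 by simp
      qed
      moreover have "nat (b d) = Suc d" using init[of d] 2 d by simp
      ultimately show ?thesis using mac_pow_Suc_ge[of d] d by simp
    next
      case 3
      have "nat (b d) \<le> d" using le_t[of d] 3 d by simp
      from mac_pow_ge[OF macaulay_rep_le[OF this]] show ?thesis
        using decr[of d] 3 d pos[of d] by simp
    qed
  qed
  show ?thesis
    unfolding O_seq_def
    using nth pos growth b0 by (auto simp del: upt_Suc map_map)
qed

section \<open>Gorenstein ideals from grid points\<close>

text \<open>Stated for an indexed family: a repeated vector would already be a nontrivial relation,
  so injectivity comes along and cardinalities can be read off the index set.\<close>

lemma independent_family:
  fixes N :: "'i \<Rightarrow> ('v, 'k::field) mpoly"
  assumes A: "finite A" and c: "\<And>c p. (\<Sum>p\<in>A. pscale (c p) (N p)) = 0 \<Longrightarrow> p \<in> A \<Longrightarrow> c p = 0"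
  shows "inj_on N A" "mp.independent (N ` A)"
proof -
  show inj: "inj_on N A"
  proof (rule inj_onI, rule ccontr)
    fix p q assume pq: "p \<in> A" "q \<in> A" "N p = N q" "p \<noteq> q"
    define c where "c r = (if r = p then 1 else if r = q then - 1 else 0 :: 'k)" for r
    have "(\<Sum>r\<in>A. pscale (c r) (N r)) = (\<Sum>r\<in>{p, q}. pscale (c r) (N r))"
      by (rule sum.mono_neutral_right) (use A pq in \<open>auto simp: c_def\<close>)
    also have "\<dots> = 0" using pq by (simp add: c_def)
    finally have "c p = 0" using assms(2) pq(1) by blast
    then show False by (simp add: c_def)
  qed
  show "mp.independent (N ` A)"
  proof (rule mp.independent_if_scalars_zero)
    fix f x assume "(\<Sum>x\<in>N ` A. pscale (f x) x) = 0" and x: "x \<in> N ` A"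
    then have "(\<Sum>p\<in>A. pscale (f (N p)) (N p)) = 0" by (simp add: sum.reindex[OF inj])
    then show "f x = 0" using c[of "\<lambda>p. f (N p)"] x by blast
  qed (use A in simp)
qed

locale newton_grid =
  fixes \<alpha> :: "nat \<Rightarrow> 'k::field"
  assumes inj: "inj \<alpha>"
begin

text \<open>The pair \<open>(i, k)\<close> stands for the projective point \<open>(\<alpha>\<^sub>i : \<alpha>\<^sub>k : 1)\<close>.\<close>

definition point :: "nat \<times> nat \<Rightarrow> var3 \<Rightarrow> 'k" where
  "point P v = (case v of X3 \<Rightarrow> \<alpha> (fst P) | Y3 \<Rightarrow> \<alpha> (snd P) | Z3 \<Rightarrow> 1)"

sublocale pt: mpoly_eval "\<lambda>a::'k. a" "point P" for P
  by unfold_locales auto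

abbreviation evp :: "nat \<times> nat \<Rightarrow> (var3, 'k) mpoly \<Rightarrow> 'k" where
  "evp P \<equiv> pt.ev P"

text \<open>Newton's interpolation basis in two variables, homogenised to degree \<open>d\<close> by
  \<open>z\<close>.\<close>

definition newton :: "nat \<Rightarrow> nat \<times> nat \<Rightarrow> (var3, 'k) mpoly" where
  "newton d P = (\<Prod>a<fst P. var X3 - pscale (\<alpha> a) (var Z3)) * (\<Prod>b<snd P. var Y3 - pscale (\<alpha> b) (var Z3))
     * var Z3 ^ (d - (fst P + snd P))"

text \<open>The index set of the Newton basis of the forms of degree \<open>d\<close>.\<close>

definition tri :: "nat \<Rightarrow> (nat \<times> nat) set" where
  "tri d = {P. fst P + snd P \<le> d}"

lemma finite_tri [simp]: "finite (tri d)"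
  by (rule finite_subset[of _ "{..d} \<times> {..d}"]) (auto simp: tri_def)

lemma homog_prod_linear:
  assumes "\<And>a. l a \<in> homog 1"
  shows "(\<Prod>a<n. l a) \<in> (homog n :: (var3, 'k) mpoly set)"
proof (induction n)
  case (Suc n)
  then show ?case using homog_mult[OF Suc assms[of n]] by simp
qed simp

lemma newton_homog:
  assumes "P \<in> tri d"
  shows "newton d P \<in> homog d"
proof -
  have "newton d P \<in> homog (fst P + snd P + (d - (fst P + snd P)) * 1)"
    unfolding newton_def
    by (intro homog_mult homog_prod_linear homog_power homog_diff homog_pscale var_homog)
  then show ?thesis using assms by (simp add: tri_def)
qed

lemma evp_newton: "evp Q (newton d P) = (\<Prod>a<fst P. \<alpha> (fst Q) - \<alpha> a) * (\<Prod>b<snd P. \<alpha> (snd Q) - \<alpha> b)"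
  by (simp add: newton_def pt.ev_mult pt.ev_prod pt.ev_diff pt.ev_pscale pt.ev_power point_def)

text \<open>By injectivity of \<open>\<alpha>\<close> a factor vanishes exactly when a coordinate of
  \<open>Q\<close> is among the nodes used. Hence the evaluation matrix is triangular for the
  componentwise order.\<close>

lemma evp_newton_eq_0_iff: "evp Q (newton d P) = 0 \<longleftrightarrow> \<not> (fst P \<le> fst Q \<and> snd P \<le> snd Q)"
proof -
  have "(\<Prod>a<n. \<alpha> m - \<alpha> a) = 0 \<longleftrightarrow> m < n" for m n
    using inj by (auto simp: inj_eq)
  then show ?thesis unfolding evp_newton by (auto simp: not_le)
qed

text \<open>Newton's recursion: multiplying by \<open>x\<close> gives the next basis element in the
  first index plus \<open>\<alpha> i\<close> times the product with \<open>z\<close>, and likewise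
  for \<open>y\<close>.\<close>

lemma homog_subset_span_newton: "homog d \<subseteq> mp.span (newton d ` tri d)"
proof (induction d)
  case 0
  have "newton 0 (0, 0) \<in> mp.span (newton 0 ` tri 0)"
    by (intro mp.span_base imageI) (simp add: tri_def)
  then have one: "1 \<in> mp.span (newton 0 ` tri 0)" by (simp add: newton_def)
  show ?case
  proof
    fix f :: "(var3, 'k) mpoly" assume "f \<in> homog 0"
    then obtain c where "f = pscale c 1" by (rule homog_0E)
    then show "f \<in> mp.span (newton 0 ` tri 0)" using mp.span_scale[OF one] by simp
  qed
next
  case (Suc d)
  let ?S = "mp.span (newton (Suc d) ` tri (Suc d))"
  show ?case
  proof (rule homog_Suc_subset[OF mp.subspace_span])
    fix v and q :: "(var3, 'k) mpoly" assume "q \<in> homog d"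
    then have q: "q \<in> mp.span (newton d ` tri d)" using Suc by blast
    have sub: "mp.subspace {q. var v * q \<in> ?S}"
      by (auto simp: mp.subspace_def distrib_left intro: mp.span_zero mp.span_add mp.span_scale)
    have "var v * newton d P \<in> ?S" if P: "P \<in> tri d" for P
    proof -
      obtain i k where ik: "P = (i, k)" by (cases P)
      have le: "i + k \<le> d" using P ik by (simp add: tri_def)
      have mem: "newton (Suc d) (Suc i, k) \<in> ?S" "newton (Suc d) (i, Suc k) \<in> ?S" "newton (Suc d) (i, k) \<in> ?S"
        using le by (intro mp.span_base imageI; simp add: tri_def)+
      have z: "var Z3 * newton d P = newton (Suc d) (i, k)"
        using le unfolding newton_def ik by (simp add: Suc_diff_le mult_ac)
      have "newton (Suc d) (Suc i, k) = (var X3 - pscale (\<alpha> i) (var Z3)) * newton d P"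
        unfolding newton_def ik by (simp add: mult_ac)
      then have x: "var X3 * newton d P = newton (Suc d) (Suc i, k) + pscale (\<alpha> i) (newton (Suc d) (i, k))"
        by (simp add: z[symmetric] left_diff_distrib)
      have "newton (Suc d) (i, Suc k) = (var Y3 - pscale (\<alpha> k) (var Z3)) * newton d P"
        unfolding newton_def ik by (simp add: mult_ac)
      then have y: "var Y3 * newton d P = newton (Suc d) (i, Suc k) + pscale (\<alpha> k) (newton (Suc d) (i, k))"
        by (simp add: z[symmetric] left_diff_distrib)
      show ?thesis
        by (cases v) (auto simp only: x y z intro!: mp.span_add mp.span_scale mem)
    qed
    then have "newton d ` tri d \<subseteq> {q. var v * q \<in> ?S}" by blast
    then have "mp.span (newton d ` tri d) \<subseteq> {q. var v * q \<in> ?S}" by (rule mp.span_minimal[OF _ sub])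
    then show "var v * q \<in> ?S" using q by blast
  qed
qed

text \<open>At \<open>P\<close> only indices below \<open>P\<close> contribute. They lie in
  \<open>D\<close> and have smaller coordinate sum unless equal to \<open>P\<close>, so induction on
  that sum isolates \<open>c P\<close>.\<close>

lemma newton_triangular:
  assumes A: "finite A" and D: "D \<subseteq> A"
    and down: "\<And>P Q. P \<in> D \<Longrightarrow> Q \<in> A \<Longrightarrow> fst Q \<le> fst P \<Longrightarrow> snd Q \<le> snd P \<Longrightarrow> Q \<in> D"
    and f: "\<And>P. P \<in> D \<Longrightarrow> evp P (\<Sum>Q\<in>A. pscale (c Q) (newton d Q)) = 0"
    and P: "P \<in> D"
  shows "c P = 0"
  using P
proof (induction "fst P + snd P" arbitrary: P rule: less_induct)
  case less
  have "0 = (\<Sum>Q\<in>A. c Q * evp P (newton d Q))"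
    using f[OF less.prems] by (simp add: pt.ev_sum pt.ev_pscale)
  also have "\<dots> = (\<Sum>Q\<in>{P}. c Q * evp P (newton d Q))"
  proof (rule sum.mono_neutral_right[OF A])
    show "\<forall>Q\<in>A - {P}. c Q * evp P (newton d Q) = 0"
    proof
      fix Q assume Q: "Q \<in> A - {P}"
      show "c Q * evp P (newton d Q) = 0"
      proof (cases "fst Q \<le> fst P \<and> snd Q \<le> snd P")
        case True
        then have "Q \<in> D" using down less.prems Q by blast
        moreover have "fst Q + snd Q < fst P + snd P"
          using True Q by (cases P; cases Q; auto)
        ultimately show ?thesis using less.hyps by simp
      next
        case False
        then show ?thesis using evp_newton_eq_0_iff[of P d Q] by simp
      qed
    qed
  qed (use less.prems D in auto)
  finally show ?case using evp_newton_eq_0_iff[of P d P] by simp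
qed

lemma newton_independent: "inj_on (newton d) (tri d)" "mp.independent (newton d ` tri d)"
proof -
  have *: "c P = 0" if "(\<Sum>P\<in>tri d. pscale (c P) (newton d P)) = 0" "P \<in> tri d" for c P
    by (rule newton_triangular[OF finite_tri order_refl, where c = c and d = d]) (use that in simp_all)
  show "inj_on (newton d) (tri d)"
    by (rule independent_family(1)[OF finite_tri]) (rule *)
  show "mp.independent (newton d ` tri d)"
    by (rule independent_family(2)[OF finite_tri]) (rule *)
qed

lemma dim_homog_newton: "mp.dim (homog d :: (var3, 'k) mpoly set) = card (tri d)"
proof (rule mp.dim_unique)
  show "newton d ` tri d \<subseteq> homog d" using newton_homog by auto
  show "homog d \<subseteq> mp.span (newton d ` tri d)" by (rule homog_subset_span_newton)
qed (use newton_independent card_image in auto)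

text \<open>For a down-closed \<open>S\<close>, vanishing on \<open>S\<close> kills exactly the
  Newton coefficients indexed by \<open>S\<close>; the remaining Newton forms are a basis.\<close>

lemma dim_vanishing:
  assumes down: "\<And>P Q. P \<in> S \<Longrightarrow> fst Q \<le> fst P \<Longrightarrow> snd Q \<le> snd P \<Longrightarrow> Q \<in> S"
  shows "mp.dim {f \<in> homog d. \<forall>P\<in>S. evp P f = 0} = card (tri d - S)"
proof (rule mp.dim_unique)
  show "newton d ` (tri d - S) \<subseteq> {f \<in> homog d. \<forall>P\<in>S. evp P f = 0}"
    using newton_homog evp_newton_eq_0_iff down by auto
  show "mp.independent (newton d ` (tri d - S))"
    by (rule mp.independent_mono[OF newton_independent(2)]) auto
  show "card (newton d ` (tri d - S)) = card (tri d - S)"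
    by (rule card_image) (rule inj_on_subset[OF newton_independent(1)], auto)
  show "{f \<in> homog d. \<forall>P\<in>S. evp P f = 0} \<subseteq> mp.span (newton d ` (tri d - S))"
  proof
    fix f assume f: "f \<in> {f \<in> homog d. \<forall>P\<in>S. evp P f = 0}"
    then have "f \<in> mp.span (newton d ` tri d)" using homog_subset_span_newton by blast
    then obtain u where u: "f = (\<Sum>x\<in>newton d ` tri d. pscale (u x) x)"
      by (auto simp: mp.span_finite)
    define c where "c P = u (newton d P)" for P
    have fc: "f = (\<Sum>P\<in>tri d. pscale (c P) (newton d P))"
      unfolding u c_def by (simp add: sum.reindex[OF newton_independent(1)])
    have c0: "c P = 0" if "P \<in> tri d \<inter> S" for P
      by (rule newton_triangular[where A = "tri d" and D = "tri d \<inter> S" and c = c and d = d])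
        (use that f down in \<open>auto simp flip: fc\<close>)
    have "f = (\<Sum>P\<in>tri d - S. pscale (c P) (newton d P))"
      unfolding fc by (rule sum.mono_neutral_right) (use c0 in auto)
    then show "f \<in> mp.span (newton d ` (tri d - S))"
      by (auto intro: mp.span_sum mp.span_scale mp.span_base)
  qed
qed

end

text \<open>The functional is the sum of the evaluations at the points of \<open>S\<close>. Up to
  degree \<open>j / 2\<close> the complementary forms separate these points, so \<open>Ann\<close>
  consists there of the forms vanishing on \<open>S\<close>, and \<open>dim_vanishing\<close> counts
  them.\<close>

lemma order_ideal_gorenstein:
  fixes S :: "(nat \<times> nat) set" and j :: nat
  assumes inf: "infinite (UNIV :: 'k::field set)"
    and S: "finite S" "(0, 0) \<in> S"
    and down: "\<And>P Q. P \<in> S \<Longrightarrow> fst Q \<le> fst P \<Longrightarrow> snd Q \<le> snd P \<Longrightarrow> Q \<in> S"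
    and deg: "\<And>P. P \<in> S \<Longrightarrow> 2 * (fst P + snd P) \<le> j"
  obtains I :: "(var3, 'k::field) mpoly set" where "graded_AG I" "socle_degree I j"
    "\<forall>d. 2 * d \<le> j \<longrightarrow> hilb I d = card {P \<in> S. fst P + snd P \<le> d}"
    "\<forall>d\<le>j. hilb I d = hilb I (j - d)"
proof -
  obtain \<alpha> :: "nat \<Rightarrow> 'k" where "inj \<alpha>" using infinite_countable_subset[OF inf] by blast
  then interpret newton_grid \<alpha> by unfold_locales
  define \<psi> where "\<psi> f = (\<Sum>P\<in>S. evp P (hcomp j f))" for f
  interpret graded_functional \<psi> j
    by unfold_locales
      (simp_all add: \<psi>_def hcomp_add hcomp_pscale pt.ev_add pt.ev_pscale sum.distrib sum_distrib_left
        hcomp_of_homog[OF hcomp_homog])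
  have psi_mult: "\<psi> (f * g) = (\<Sum>P\<in>S. evp P f * evp P g)" if "f \<in> homog d" "g \<in> homog (j - d)" "d \<le> j" for f g d
    using hcomp_of_homog[OF homog_mult[OF that(1,2)], of j] that(3) by (simp add: \<psi>_def pt.ev_mult)
  have Ann_eq: "Ann \<inter> homog d = {f \<in> homog d. \<forall>P\<in>S. evp P f = 0}" if d: "2 * d \<le> j" for d
  proof (intro equalityI subsetI)
    have dj: "d \<le> j" using d by simp
    fix f assume "f \<in> {f \<in> homog d. \<forall>P\<in>S. evp P f = 0}"
    then show "f \<in> Ann \<inter> homog d" unfolding Ann_homog[OF dj] using psi_mult[of f d] dj by simp
  next
    have dj: "d \<le> j" using d by simp
    fix f assume "f \<in> Ann \<inter> homog d"
    then have f: "f \<in> homog d" "\<And>g. g \<in> homog (j - d) \<Longrightarrow> \<psi> (f * g) = 0"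
      unfolding Ann_homog[OF dj] by auto
    show "f \<in> {f \<in> homog d. \<forall>P\<in>S. evp P f = 0}"
    proof (rule ccontr)
      assume "f \<notin> {f \<in> homog d. \<forall>P\<in>S. evp P f = 0}"
      then have ne: "{P \<in> S. evp P f \<noteq> 0} \<noteq> {}" using f(1) by blast
      define M where "M = {P \<in> S. evp P f \<noteq> 0}"
      have M: "finite M" "M \<noteq> {}" using S ne by (auto simp: M_def)
      \<comment> \<open>With \<open>P\<close> of maximal coordinate sum, \<open>f\<close> vanishes
        at the other points of \<open>S\<close> above \<open>P\<close>, and the Newton form of index
        \<open>P\<close> vanishes at the points not above it.\<close>
      obtain P where P: "P \<in> M" and max: "\<And>Q. Q \<in> M \<Longrightarrow> fst Q + snd Q \<le> fst P + snd P"
        using Max_in[of "(\<lambda>Q. fst Q + snd Q) ` M"] Max_ge[of "(\<lambda>Q. fst Q + snd Q) ` M"] M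
        by (smt (verit) finite_imageI image_iff image_is_empty)
      have PS: "P \<in> S" "evp P f \<noteq> 0" using P by (auto simp: M_def)
      \<comment> \<open>Both \<open>d\<close> and the coordinate sum of \<open>P\<close> are at most
        \<open>j / 2\<close>, so the Newton form fits into degree \<open>j - d\<close>.\<close>
      have "P \<in> tri (j - d)" using deg[OF PS(1)] d by (simp add: tri_def)
      then have g: "newton (j - d) P \<in> homog (j - d)" by (rule newton_homog)
      have "0 = (\<Sum>Q\<in>S. evp Q f * evp Q (newton (j - d) P))"
        using psi_mult[OF f(1) g dj] f(2)[OF g] by simp
      also have "\<dots> = (\<Sum>Q\<in>{P}. evp Q f * evp Q (newton (j - d) P))"
      proof (rule sum.mono_neutral_right[OF S(1)])
        show "\<forall>Q\<in>S - {P}. evp Q f * evp Q (newton (j - d) P) = 0"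
        proof
          fix Q assume Q: "Q \<in> S - {P}"
          show "evp Q f * evp Q (newton (j - d) P) = 0"
          proof (rule ccontr)
            assume "evp Q f * evp Q (newton (j - d) P) \<noteq> 0"
            then have "Q \<in> M" "fst P \<le> fst Q" "snd P \<le> snd Q"
              using Q evp_newton_eq_0_iff[of Q "j - d" P] by (auto simp: M_def)
            then have "Q = P" using max[of Q] by (cases P; cases Q; auto)
            then show False using Q by simp
          qed
        qed
      qed (use PS in auto)
      finally show False using PS(2) evp_newton_eq_0_iff[of P "j - d" P] by simp
    qed
  qed
  have "\<exists>p. \<psi> p \<noteq> 0"
  proof (rule ccontr)
    assume "\<not> ?thesis"
    then have "1 \<in> Ann \<inter> homog 0" by (simp add: Ann_def)
    then show False unfolding Ann_eq[of 0, simplified] using S(2) by simp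
  qed
  then have AG: "graded_AG Ann" "socle_degree Ann j" using graded_AG_Ann by auto
  have hilb: "hilb Ann d = card {P \<in> S. fst P + snd P \<le> d}" if "2 * d \<le> j" for d
  proof -
    have "hilb Ann d = card (tri d) - card (tri d - S)"
      unfolding hilb_def kdim_def Ann_eq[OF that] dim_homog_newton using dim_vanishing[OF down] by simp
    also have "\<dots> = card (tri d \<inter> S)"
      using card_Diff_subset_Int[of "tri d" S] card_mono[of "tri d" "tri d \<inter> S"] by simp
    also have "tri d \<inter> S = {P \<in> S. fst P + snd P \<le> d}" by (auto simp: tri_def)
    finally show ?thesis .
  qed
  show ?thesis by (rule that[OF AG]) (use hilb hilb_Ann_sym in blast)+
qed

text \<open>On the diagonal of degree \<open>e\<close> the points are \<open>(e - k, k)\<close> with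
  \<open>k < a e\<close>; the bound on \<open>a\<close> gives \<open>k \<le> e\<close>, so the
  subtraction is exact.\<close>

lemma card_order_ideal:
  fixes a :: "nat \<Rightarrow> nat"
  assumes "\<And>e. e \<le> d \<Longrightarrow> a e \<le> e + 1"
  shows "card {P. fst P + snd P \<le> d \<and> snd P < a (fst P + snd P)} = (\<Sum>e\<le>d. a e)"
proof -
  let ?A = "{P. fst P + snd P \<le> d \<and> snd P < a (fst P + snd P)}"
  have "bij_betw (\<lambda>P. (fst P + snd P, snd P)) ?A (SIGMA e:{..d}. {..<a e})"
  proof (rule bij_betw_byWitness[where f' = "\<lambda>R. (fst R - snd R, snd R)"])
    have "snd R \<le> fst R" if "R \<in> (SIGMA e:{..d}. {..<a e})" for R
      using that assms[of "fst R"] by auto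
    then show "\<forall>R\<in>(SIGMA e:{..d}. {..<a e}). (fst (fst R - snd R, snd R) + snd (fst R - snd R, snd R),
        snd (fst R - snd R, snd R)) = R"
      and "(\<lambda>R. (fst R - snd R, snd R)) ` (SIGMA e:{..d}. {..<a e}) \<subseteq> ?A"
      by force+
  qed auto
  then have "card ?A = card (SIGMA e:{..d}. {..<a e})" by (rule bij_betw_same_card)
  then show ?thesis by simp
qed

section \<open>The \<open>O\<close>-sequence property and the height three Gorenstein
  sequence\<close>

theorem theorem3p20:
  fixes I :: "(var4, 'k::field) mpoly set" and j :: nat
  assumes "alg_closed TYPE('k)"
    and "graded_AG I"
    and "socle_degree I j"
    and "I \<inter> homog 2 = kspan {var W * var W, var W * var X, var W * var Y}"
  defines "H \<equiv> map (hilb I) [0..<j + 1]"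
  shows "O_seq (map (delta H) [0..<j div 2 + 1])
         \<and> (\<exists>H'. gorenstein_seq3 TYPE('k) H' \<and> length H' = length H
           \<and> (\<forall>i<length H. H ! i = H' ! i + (if 0 < i \<and> i < j then 1 else 0)))"
proof -
  have inf: "infinite (UNIV :: 'k set)" by (rule alg_closed_infinite[OF assms(1)])
  have hI: "homog_ideal I" using assms(2) by (simp add: graded_AG_def)
  have "hilb I j \<noteq> 0" using assms(3) by (simp add: socle_degree_def)
  then obtain p where "p \<in> homog j" "p \<notin> I" using hilb_eq_0_iff[OF hI, of j] by auto
  then obtain \<psi> where \<psi>: "graded_functional \<psi> j" "\<psi> p = 1" "I = graded_functional.Ann \<psi>"
    using graded_AG_eq_Ann[OF assms(2,3)] by metis
  then have "wxy_form \<psi> j"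
    unfolding wxy_form_def wxy_form_axioms_def using assms(4) inf by (metis zero_neq_one)
  then interpret wxy_form \<psi> j .
  note I = \<psi>(3)
  obtain t where t: "3 \<le> t" "\<And>i. 2 \<le> i \<Longrightarrow> i < t \<Longrightarrow> i \<le> j \<Longrightarrow> hilb_int i - hilb_int (i - 1) = int i + 1"
    "\<And>i. t \<le> Suc i \<Longrightarrow> Suc i \<le> j div 2 \<Longrightarrow> hilb_int (Suc i) - hilb_int i \<le> hilb_int i - hilb_int (i - 1)"
    "\<And>i. 2 \<le> i \<Longrightarrow> i \<le> j div 2 \<Longrightarrow> 0 \<le> hilb_int i - hilb_int (i - 1)"
    using hilb_int_shape by blast
  define s where "s = j div 2"
  have s: "1 \<le> s" "s \<le> j" "2 * s \<le> j" using j_ge_2 by (auto simp: s_def)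
  have Hnth: "H ! i = hilb I i" if "i \<le> j" for i
    unfolding H_def using that by (simp del: upt_Suc)
  have lenH: "length H = j + 1" by (simp add: H_def)
  have h0: "hilb_int 0 = 1" and h1: "hilb_int 1 = 4" using hilb_Ann_0 hilb_Ann_1 by (simp_all add: hilb_int_def)
  have delta: "delta H i = hilb_int i - (if i = 0 then 0 else hilb_int (i - 1))" if "i \<le> s" for i
    using that s Hnth[of i] Hnth[of "i - 1"] by (simp add: delta_def hilb_int_def I)
  have part1: "O_seq (map (delta H) [0..<j div 2 + 1])"
    unfolding s_def[symmetric]
  proof (rule O_seq_of_shape[OF _ _ t(1)])
    show "delta H 0 = 1" using delta[of 0] h0 by simp
    show "delta H 1 = 3" using delta[of 1] s h0 h1 by simp
    show "delta H i = int i + 1" if "2 \<le> i" "i < t" "i \<le> s" for i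
      using that s delta[of i] t(2)[of i] by simp
    show "delta H (Suc i) \<le> delta H i" if "t \<le> Suc i" "Suc i \<le> s" for i
      using that delta[of i] delta[of "Suc i"] t(1) t(3)[of i] unfolding s_def by simp
    show "0 \<le> delta H i" if "2 \<le> i" "i \<le> s" for i
      using that delta[of i] t(4)[of i] unfolding s_def by simp
  qed
  \<comment> \<open>The intended first difference of the height three sequence up to
    \<open>j / 2\<close>: that of \<open>H\<close> with its degree one value lowered from 3 to
    2.\<close>
  define a where "a i = (if i = 0 then 1 else if i = 1 then 2 else nat (hilb_int i - hilb_int (i - 1)))" for i
  have a_init: "a i = i + 1" if "i < t" "i \<le> s" for i
    using that s t(2)[of i] by (auto simp: a_def)
  have a_decr: "a (Suc i) \<le> a i" if "t \<le> Suc i" "Suc i \<le> s" for i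
    using that t(1) t(3)[of i] unfolding s_def a_def by auto
  have a_le: "a i \<le> t" if "t \<le> Suc i" "i \<le> s" for i
    using that
  proof (induction i)
    case (Suc i)
    show ?case
    proof (cases "t \<le> Suc i")
      case True
      then show ?thesis using Suc a_decr[of i] by simp
    next
      case False
      then show ?thesis using Suc a_init[of "Suc i"] by simp
    qed
  qed (use t(1) in simp)
  have a_le_Suc: "a i \<le> i + 1" if "i \<le> s" for i
    using a_init[of i] a_le[of i] that by (cases "i < t") auto
  have a_step: "k < a e'" if "k < a e" "k \<le> e'" "e = Suc e'" "e \<le> s" for e e' k
  proof (cases "t \<le> e")
    case True
    then show ?thesis using a_decr[of e'] that by simp
  next
    case False
    then show ?thesis using a_init[of e'] that by simp
  qed
  \<comment> \<open>This makes \<open>S\<close> below down-closed. Descending in degree,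
    \<open>a\<close> either does not decrease or takes its full value
    \<open>e' + 1 > k\<close>.\<close>
  have a_down: "k < a e'" if "k < a e" "k \<le> e'" "e' \<le> e" "e \<le> s" for e e' k
    using that(3,1,2,4)
  proof (induction e rule: dec_induct)
    case (step n)
    then show ?case using a_step[of k "Suc n" n] by simp
  qed
  define S where "S = {P. fst P + snd P \<le> s \<and> snd P < a (fst P + snd P)}"
  have S: "finite S" "(0, 0) \<in> S"
    by (rule finite_subset[of _ "{..s} \<times> {..s}"]) (auto simp: S_def a_def)
  have down: "Q \<in> S" if P: "P \<in> S" and Q: "fst Q \<le> fst P" "snd Q \<le> snd P" for P Q
  proof -
    have "snd Q < a (fst P + snd P)" "fst P + snd P \<le> s" using P Q by (auto simp: S_def)
    then show ?thesis using a_down[of "snd Q" "fst P + snd P" "fst Q + snd Q"] Q by (simp add: S_def)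
  qed
  have deg: "2 * (fst P + snd P) \<le> j" if "P \<in> S" for P
    using that s by (auto simp: S_def)
  obtain I' :: "(var3, 'k) mpoly set" where I': "graded_AG I'" "socle_degree I' j"
    "\<forall>d. 2 * d \<le> j \<longrightarrow> hilb I' d = card {P \<in> S. fst P + snd P \<le> d}"
    "\<forall>d\<le>j. hilb I' d = hilb I' (j - d)"
    by (rule order_ideal_gorenstein[OF inf S down deg]) blast
  \<comment> \<open>The sum telescopes, and the lowered value in degree one accounts for the missing
    1 in every positive degree.\<close>
  have sum_a: "int (\<Sum>e\<le>d. a e) = hilb_int d - (if d = 0 then 0 else 1)" if "d \<le> s" for d
    using that
  proof (induction d)
    case 0
    then show ?case using h0 by (simp add: a_def)
  next
    case (Suc d)
    show ?case
    proof (cases "d = 0")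
      case True
      then show ?thesis using h1 by (simp add: a_def)
    next
      case False
      then have "int (a (Suc d)) = hilb_int (Suc d) - hilb_int d"
        using t(4)[of "Suc d"] Suc.prems by (simp add: a_def s_def)
      then show ?thesis using Suc False by simp
    qed
  qed
  have hilb_low: "hilb I d = hilb I' d + (if 0 < d \<and> d < j then 1 else 0)" if d: "d \<le> s" for d
  proof -
    have "hilb I' d = card {P. fst P + snd P \<le> d \<and> snd P < a (fst P + snd P)}"
      using I'(3) d s by (auto simp: S_def intro!: arg_cong[of _ _ card])
    also have "\<dots> = (\<Sum>e\<le>d. a e)" by (rule card_order_ideal) (use a_le_Suc d in auto)
    finally have "int (hilb I' d) = hilb_int d - (if d = 0 then 0 else 1)" using sum_a[OF d] by simp
    moreover have "d < j" using d s j_ge_2 by (simp add: s_def)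
    ultimately show ?thesis by (auto simp: hilb_int_def I split: if_splits)
  qed
  have hilb_all: "hilb I d = hilb I' d + (if 0 < d \<and> d < j then 1 else 0)" if d: "d \<le> j" for d
  proof (cases "d \<le> s")
    case True
    then show ?thesis by (rule hilb_low)
  next
    case False
    \<comment> \<open>Above \<open>j / 2\<close> both Hilbert functions and the added sequence are
      symmetric under \<open>d \<mapsto> j - d\<close>.\<close>
    then have "j - d \<le> s" by (simp add: s_def)
    from hilb_low[OF this] show ?thesis
      using hilb_Ann_sym[OF d] I'(4)[rule_format, OF d] False d by (auto simp: I split: if_splits)
  qed
  define H' where "H' = map (hilb I') [0..<j + 1]"
  have H'nth: "H' ! i = hilb I' i" if "i \<le> j" for i
    unfolding H'_def using that by (simp del: upt_Suc)
  have "hilb I' 1 = 3"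
    using hilb_all[of 1] hilb_Ann_1 j_ge_2 by (simp add: I)
  then have "gorenstein_seq3 TYPE('k) H'"
    unfolding gorenstein_seq3_def using I'(1,2) H'nth
    by (intro exI[of _ I']) (auto simp: H'_def simp del: upt_Suc)
  moreover have "length H' = length H" by (simp add: H'_def H_def)
  moreover have "\<forall>i<length H. H ! i = H' ! i + (if 0 < i \<and> i < j then 1 else 0)"
    using hilb_all Hnth H'nth lenH by simp
  ultimately show ?thesis using part1 by blast
qed

end
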